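(* Suppose $\Gamma$ is a reduced injective labeled oriented tree (LOT) that contains a sub-LOT $\Gamma_1$ so that 1. $K(\Gamma_1)$ has collapsing non-positive immersion; 2. identifying $\Gamma_1$ to one of its vertices produces a reduced quotient LOT $\bar\Gamma$ without boundary reducible sub-LOTs. Then $K(\Gamma)$ has collapsing non-positive immersion.
   Context: A labeled oriented graph (LOG) $\Gamma=(E,V,s,t,\lambda)$ consists of two (finite) sets $E$, $V$ of edges and vertices and three maps $s,t,\lambda\colon E\to V$ called source, target and label. It is a labeled oriented tree (LOT) if the underlying graph is a tree. The associated presentation is $P(\Gamma)=\langle V\mid s(e)\lambda(e)=\lambda(e)t(e),\ e\in E\rangle$, and the LOG complex $K(\Gamma)$ is the standard 2-complex of this presentation (one vertex, one edge per generator, one 2-cell per relator). A sub-LOG $\Gamma_0=(E_0,V_0)\subseteq\Gamma$ is a (connected, in the LOT case: a subtree) subgraph with $E_0\neq\emptyset$ and $\lambda(E_0)\subseteq V_0$; a sub-LOG of a LOT that is a tree is a sub-LOT. A LOG is boundary reduced if whenever $v$ is a vertex of valency 1 then $v=\lambda(e)$ for some edge $e$; it is boundary reducible if it is not boundary reduced. It is interior reduced if for every vertex $v$ no two edges starting at $v$, and no two edges terminating at $v$, carry the same label. It is compressed if for every edge $e$ the label $\lambda(e)$ is not equal to $s(e)$ or $t(e)$. It is reduced if it is boundary reduced, interior reduced and compressed. It is injective if $\lambda\colon E\to V$ is injective. Identifying a sub-LOT $\Gamma_1$ to one of its vertices $y$: the subtree $\Gamma_1$ is collapsed to the single vertex $y$,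 and every label of a remaining edge that is a vertex of $\Gamma_1$ is replaced by $y$. An $n$-cell in a complex is free if it is used exactly once in an attaching map of a unique $(n+1)$-cell. A map of 2-complexes is combinatorial if it maps open cells homeomorphically to open cells; it is an immersion if it is locally injective. A 2-complex $K$ has collapsing non-positive immersion if for every combinatorial immersion $X\to K$, where $X$ is finite, connected, and without free vertices or edges, either $\chi(X)\le 0$ or $X$ is a point. *)

theory Defs
  imports "Graph_Theory.Digraph_Component"
begin

section \<open>Undirected notions for directed multigraphs\<close>

text \<open>
  A dart \<open>(a, True)\<close> is the arc \<open>a\<close> traversed from tail to head, \<open>(a, False)\<close> is \<open>a\<close> traversed
  backwards. Edge paths that ignore orientations are the arc walks of the doubled graph. Darts also
  serve as letters of words in a free group, with \<open>(x, False)\<close> standing for the inverse of \<open>x\<close>.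
\<close>

type_synonym 'e dart = "'e \<times> bool"

fun inv_dart :: "'e dart \<Rightarrow> 'e dart" where
  "inv_dart (a, b) = (a, \<not> b)"

definition inv_word :: "'e dart list \<Rightarrow> 'e dart list" where
  "inv_word w = rev (map inv_dart w)"

definition doubled :: "('v, 'e) pre_digraph \<Rightarrow> ('v, 'e dart) pre_digraph" where
  "doubled G = \<lparr> verts = verts G, arcs = arcs G \<times> UNIV,
     tail = (\<lambda>(a, b). if b then tail G a else head G a),
     head = (\<lambda>(a, b). if b then head G a else tail G a) \<rparr>"

definition star :: "('v, 'e) pre_digraph \<Rightarrow> 'v \<Rightarrow> 'e dart set" where
  "star G v = out_arcs (doubled G) v"

text \<open>A loop contributes two to the valency of its vertex.\<close>

definition valency :: "('v, 'e) pre_digraph \<Rightarrow> 'v \<Rightarrow> nat" where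
  "valency G v = card (star G v)"

text \<open>
  The library predicate \<^const>\<open>tree\<close> only excludes directed cycles, so it is not used here. The
  condition \<open>distinct (map fst p)\<close> excludes walking back and forth along one edge; loops and pairs of
  parallel edges do count as cycles.
\<close>

definition undirected_cycle :: "('v, 'e) pre_digraph \<Rightarrow> 'e dart list \<Rightarrow> bool" where
  "undirected_cycle G p \<longleftrightarrow> pre_digraph.cycle (doubled G) p \<and> distinct (map fst p)"

definition undirected_tree :: "('v, 'e) pre_digraph \<Rightarrow> bool" where
  "undirected_tree G \<longleftrightarrow> connected G \<and> \<not> (\<exists>p. undirected_cycle G p)"


section \<open>Labeled oriented graphs and trees\<close>

text \<open>The source and target maps are \<^const>\<open>tail\<close> and \<^const>\<open>head\<close> of the underlying graph.\<close>

record ('v, 'e) lgraph =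
  ugraph :: "('v, 'e) pre_digraph"
  label :: "'e \<Rightarrow> 'v"

definition LOG :: "('v, 'e) lgraph \<Rightarrow> bool" where
  "LOG \<Gamma> \<longleftrightarrow> fin_digraph (ugraph \<Gamma>) \<and> label \<Gamma> ` arcs (ugraph \<Gamma>) \<subseteq> verts (ugraph \<Gamma>)"

definition LOT :: "('v, 'e) lgraph \<Rightarrow> bool" where
  "LOT \<Gamma> \<longleftrightarrow> LOG \<Gamma> \<and> undirected_tree (ugraph \<Gamma>)"

definition sub_LOT :: "('v, 'e) lgraph \<Rightarrow> ('v, 'e) lgraph \<Rightarrow> bool" where
  "sub_LOT \<Gamma>0 \<Gamma> \<longleftrightarrow>
     subgraph (ugraph \<Gamma>0) (ugraph \<Gamma>) \<and> label \<Gamma>0 = label \<Gamma> \<and>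
     undirected_tree (ugraph \<Gamma>0) \<and> arcs (ugraph \<Gamma>0) \<noteq> {} \<and>
     label \<Gamma> ` arcs (ugraph \<Gamma>0) \<subseteq> verts (ugraph \<Gamma>0)"

definition boundary_reduced :: "('v, 'e) lgraph \<Rightarrow> bool" where
  "boundary_reduced \<Gamma> \<longleftrightarrow>
     (\<forall>v \<in> verts (ugraph \<Gamma>). valency (ugraph \<Gamma>) v = 1 \<longrightarrow> (\<exists>e \<in> arcs (ugraph \<Gamma>). v = label \<Gamma> e))"

abbreviation boundary_reducible :: "('v, 'e) lgraph \<Rightarrow> bool" where
  "boundary_reducible \<Gamma> \<equiv> \<not> boundary_reduced \<Gamma>"

definition interior_reduced :: "('v, 'e) lgraph \<Rightarrow> bool" where
  "interior_reduced \<Gamma> \<longleftrightarrow>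
     (\<forall>v \<in> verts (ugraph \<Gamma>). inj_on (label \<Gamma>) (out_arcs (ugraph \<Gamma>) v) \<and>
                          inj_on (label \<Gamma>) (in_arcs (ugraph \<Gamma>) v))"

definition compressed :: "('v, 'e) lgraph \<Rightarrow> bool" where
  "compressed \<Gamma> \<longleftrightarrow>
     (\<forall>e \<in> arcs (ugraph \<Gamma>). label \<Gamma> e \<noteq> tail (ugraph \<Gamma>) e \<and> label \<Gamma> e \<noteq> head (ugraph \<Gamma>) e)"

definition reduced_LOG :: "('v, 'e) lgraph \<Rightarrow> bool" where
  "reduced_LOG \<Gamma> \<longleftrightarrow> boundary_reduced \<Gamma> \<and> interior_reduced \<Gamma> \<and> compressed \<Gamma>"

definition injective_LOG :: "('v, 'e) lgraph \<Rightarrow> bool" where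
  "injective_LOG \<Gamma> \<longleftrightarrow> inj_on (label \<Gamma>) (arcs (ugraph \<Gamma>))"

definition identify_sub_LOT :: "('v, 'e) lgraph \<Rightarrow> ('v, 'e) lgraph \<Rightarrow> 'v \<Rightarrow> ('v, 'e) lgraph" where
  "identify_sub_LOT \<Gamma> \<Gamma>1 y =
     (let q = (\<lambda>v. if v \<in> verts (ugraph \<Gamma>1) then y else v) in
      \<lparr> ugraph = \<lparr> verts = q ` verts (ugraph \<Gamma>), arcs = arcs (ugraph \<Gamma>) - arcs (ugraph \<Gamma>1),
                   tail = q \<circ> tail (ugraph \<Gamma>), head = q \<circ> head (ugraph \<Gamma>) \<rparr>,
        label = q \<circ> label \<Gamma> \<rparr>)"


section \<open>Combinatorial 2-complexes\<close>

text \<open>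
  A 2-complex is given by its 1-skeleton and, for each 2-cell \<open>f\<close>, the closed edge path \<open>bd f\<close> along
  which \<open>f\<close> is attached. The 2-cell is regarded as a polygon with \<open>length (bd f)\<close> sides; side \<open>i\<close>
  runs from corner \<open>i\<close> to corner \<open>i + 1\<close> (cyclically) and is glued to the dart \<open>bd f ! i\<close>.
\<close>

record ('v, 'e, 'f) complex2 =
  skel :: "('v, 'e) pre_digraph"
  faces :: "'f set"
  bd :: "'f \<Rightarrow> 'e dart list"

definition is_complex2 :: "('v, 'e, 'f) complex2 \<Rightarrow> bool" where
  "is_complex2 X \<longleftrightarrow> wf_digraph (skel X) \<and>
     (\<forall>f \<in> faces X. bd X f \<noteq> [] \<and> (\<exists>u. pre_digraph.awalk (doubled (skel X)) u (bd X f) u))"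

definition finite_complex2 :: "('v, 'e, 'f) complex2 \<Rightarrow> bool" where
  "finite_complex2 X \<longleftrightarrow> finite (verts (skel X)) \<and> finite (arcs (skel X)) \<and> finite (faces X)"

definition euler_char :: "('v, 'e, 'f) complex2 \<Rightarrow> int" where
  "euler_char X = int (card (verts (skel X))) - int (card (arcs (skel X))) + int (card (faces X))"

definition is_point :: "('v, 'e, 'f) complex2 \<Rightarrow> bool" where
  "is_point X \<longleftrightarrow> (\<exists>v. verts (skel X) = {v}) \<and> arcs (skel X) = {} \<and> faces X = {}"

definition sides_at :: "('v, 'e, 'f) complex2 \<Rightarrow> 'e \<Rightarrow> ('f \<times> nat) set" where
  "sides_at X a = {(f, i). f \<in> faces X \<and> i < length (bd X f) \<and> fst (bd X f ! i) = a}"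

definition corners_at :: "('v, 'e, 'f) complex2 \<Rightarrow> 'v \<Rightarrow> ('f \<times> nat) set" where
  "corners_at X v =
     {(f, i). f \<in> faces X \<and> i < length (bd X f) \<and> tail (doubled (skel X)) (bd X f ! i) = v}"

text \<open>
  The attaching map of an edge uses a vertex once for each of its ends there, and the attaching map
  of a 2-cell uses an edge once for each side glued to it, in either direction.
\<close>

definition free_vertex :: "('v, 'e, 'f) complex2 \<Rightarrow> 'v \<Rightarrow> bool" where
  "free_vertex X v \<longleftrightarrow> v \<in> verts (skel X) \<and> (\<exists>!d. d \<in> star (skel X) v)"

definition free_edge :: "('v, 'e, 'f) complex2 \<Rightarrow> 'e \<Rightarrow> bool" where
  "free_edge X a \<longleftrightarrow> a \<in> arcs (skel X) \<and> (\<exists>!s. s \<in> sides_at X a)"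


section \<open>Combinatorial maps and immersions\<close>

text \<open>
  A map that sends open cells homeomorphically to open cells is recorded by its effect on cells: an
  edge goes to an edge, possibly reversing the chosen orientation, and the polygon of a 2-cell \<open>f\<close>
  goes to the polygon of its image by the rotation (if \<open>\<not> flip f\<close>) or the reflection (if \<open>flip f\<close>)
  that takes corner \<open>0\<close> to corner \<open>shift f\<close>.
\<close>

record ('v, 'e, 'f, 'v2, 'e2, 'f2) cell_map =
  vmap :: "'v \<Rightarrow> 'v2"
  emap :: "'e \<Rightarrow> 'e2 dart"
  face_map :: "'f \<Rightarrow> 'f2"
  shift :: "'f \<Rightarrow> nat"
  flip :: "'f \<Rightarrow> bool"

fun dart_map :: "('v, 'e, 'f, 'v2, 'e2, 'f2) cell_map \<Rightarrow> 'e dart \<Rightarrow> 'e2 dart" where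
  "dart_map \<phi> (a, b) = (if b then emap \<phi> a else inv_dart (emap \<phi> a))"

text \<open>
  Indices are taken modulo the number \<open>n\<close> of sides. A reflection that takes corner \<open>0\<close> to corner \<open>k\<close>
  takes corner \<open>i\<close> to corner \<open>k - i\<close> and hence side \<open>i\<close>, which lies between the corners \<open>i\<close> and
  \<open>i + 1\<close>, to side \<open>k - i - 1\<close>.
\<close>

definition corner_map ::
  "('v, 'e, 'f) complex2 \<Rightarrow> ('v, 'e, 'f, 'v2, 'e2, 'f2) cell_map \<Rightarrow> 'f \<times> nat \<Rightarrow> 'f2 \<times> nat" where
  "corner_map X \<phi> = (\<lambda>(f, i). let n = length (bd X f) in
     (face_map \<phi> f, (if flip \<phi> f then shift \<phi> f + (n - i) else shift \<phi> f + i) mod n))"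

definition side_map ::
  "('v, 'e, 'f) complex2 \<Rightarrow> ('v, 'e, 'f, 'v2, 'e2, 'f2) cell_map \<Rightarrow> 'f \<times> nat \<Rightarrow> 'f2 \<times> nat" where
  "side_map X \<phi> = (\<lambda>(f, i). let n = length (bd X f) in
     (face_map \<phi> f, (if flip \<phi> f then shift \<phi> f + (n - i - 1) else shift \<phi> f + i) mod n))"

definition combinatorial_map ::
  "('v, 'e, 'f) complex2 \<Rightarrow> ('v2, 'e2, 'f2) complex2 \<Rightarrow> ('v, 'e, 'f, 'v2, 'e2, 'f2) cell_map \<Rightarrow> bool"
where
  "combinatorial_map X Y \<phi> \<longleftrightarrow>
     (\<forall>v \<in> verts (skel X). vmap \<phi> v \<in> verts (skel Y)) \<and>
     (\<forall>a \<in> arcs (skel X). emap \<phi> a \<in> arcs (doubled (skel Y)) \<and>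
        tail (doubled (skel Y)) (emap \<phi> a) = vmap \<phi> (tail (skel X) a) \<and>
        head (doubled (skel Y)) (emap \<phi> a) = vmap \<phi> (head (skel X) a)) \<and>
     (\<forall>f \<in> faces X. face_map \<phi> f \<in> faces Y \<and>
        length (bd Y (face_map \<phi> f)) = length (bd X f) \<and>
        (\<forall>i < length (bd X f).
           bd Y (face_map \<phi> f) ! snd (side_map X \<phi> (f, i)) =
           (if flip \<phi> f then inv_dart (dart_map \<phi> (bd X f ! i)) else dart_map \<phi> (bd X f ! i))))"

text \<open>
  Local injectivity, point by point. It is automatic inside 2-cells. A small neighbourhood of an
  inner point of an edge \<open>a\<close> consists of a segment of \<open>a\<close> with one half-disc for each side glued to
  \<open>a\<close>. A small neighbourhood of a vertex \<open>v\<close> consists of one segment for each dart starting at \<open>v\<close>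
  and one sector for each corner at \<open>v\<close>. Each of these open pieces is mapped injectively to a
  piece of the same kind, so local injectivity says that distinct pieces have distinct images.
\<close>

definition immersion ::
  "('v, 'e, 'f) complex2 \<Rightarrow> ('v, 'e, 'f, 'v2, 'e2, 'f2) cell_map \<Rightarrow> bool" where
  "immersion X \<phi> \<longleftrightarrow>
     (\<forall>a \<in> arcs (skel X). inj_on (side_map X \<phi>) (sides_at X a)) \<and>
     (\<forall>v \<in> verts (skel X). inj_on (dart_map \<phi>) (star (skel X) v) \<and>
                            inj_on (corner_map X \<phi>) (corners_at X v))"

text \<open>
  Every finite complex is isomorphic to one whose cells are natural numbers, so quantifying over
  such \<open>X\<close> covers all finite complexes. A complex is connected iff its 1-skeleton is.
\<close>

definition collapsing_nonpositive_immersion :: "('v, 'e, 'f) complex2 \<Rightarrow> bool" where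
  "collapsing_nonpositive_immersion K \<longleftrightarrow>
     (\<forall>(X :: (nat, nat, nat) complex2) \<phi>.
        is_complex2 X \<and> finite_complex2 X \<and> connected (skel X) \<and>
        (\<nexists>v. free_vertex X v) \<and> (\<nexists>a. free_edge X a) \<and>
        combinatorial_map X K \<phi> \<and> immersion X \<phi> \<longrightarrow>
        euler_char X \<le> 0 \<or> is_point X)"


section \<open>Presentations and LOG complexes\<close>

text \<open>Relators are indexed by a set, so that a presentation may repeat a relator.\<close>

record ('g, 'r) presentation =
  gens :: "'g set"
  rels :: "'r set"
  relator :: "'r \<Rightarrow> 'g dart list"

definition standard_complex :: "('g, 'r) presentation \<Rightarrow> (unit, 'g, 'r) complex2" where
  "standard_complex P =
     \<lparr> skel = \<lparr> verts = {()}, arcs = gens P, tail = (\<lambda>_. ()), head = (\<lambda>_. ()) \<rparr>,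
       faces = rels P, bd = relator P \<rparr>"

definition LOG_presentation :: "('v, 'e) lgraph \<Rightarrow> ('v, 'e) presentation" where
  "LOG_presentation \<Gamma> =
     \<lparr> gens = verts (ugraph \<Gamma>), rels = arcs (ugraph \<Gamma>),
       relator = (\<lambda>e. [(tail (ugraph \<Gamma>) e, True), (label \<Gamma> e, True)] @
                      inv_word [(label \<Gamma> e, True), (head (ugraph \<Gamma>) e, True)]) \<rparr>"

definition LOG_complex :: "('v, 'e) lgraph \<Rightarrow> (unit, 'v, 'e) complex2" where
  "LOG_complex \<Gamma> = standard_complex (LOG_presentation \<Gamma>)"

end

theory Submission
  imports Defs
begin

text \<open>
  In the link of the vertex of \<open>K(\<Gamma>)\<close> an edge \<open>e\<close> contributes four corners, each joining an end of
  \<open>label e\<close> to an end of \<open>s(e)\<close> or \<open>t(e)\<close>. A zero-one angle structure is obtained as follows. In the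
  quotient LOT draw an arrow from each label to the two endpoints of the edge it labels. A vertex set
  that avoids the unique non-label and is left by at most one arrow would yield a boundary reducible
  sub-LOT, so by Edmonds' theorem the arrows split into two spanning arborescences. They determine
  for each generator which of its ends is of class \<open>True\<close> and which of class \<open>False\<close>, such that the
  corners joining ends of class \<open>c\<close>, one per edge and class, form a tree for each \<open>c\<close>. These corners
  get angle \<open>0\<close>, the other two get angle \<open>\<pi>\<close>. Both trees are rooted at \<open>y\<close>.

  Let \<open>X\<close> be immersed in \<open>K(\<Gamma>)\<close> without free cells and let \<open>Y\<close> be the preimage of \<open>K(\<Gamma>1)\<close>. Sending a
  corner of angle \<open>0\<close> outside \<open>Y\<close> to its child dart is injective; the darts outside \<open>Y\<close> that are
  missed are called orphans, and \<open>2 \<chi>(X) = 2 \<chi>(Y) - #orphans\<close>. A component \<open>C\<close> of \<open>Y\<close> either has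
  \<open>\<chi>(C) \<le> 0\<close>, or it collapses to a point, has \<open>\<chi>(C) = 1\<close> and carries a height function that increases
  by one along each generator. In the latter case \<open>C\<close> meets at least two orphans unless \<open>X\<close> is a
  point: among the vertices of \<open>C\<close> at which cells outside \<open>Y\<close> are attached along an edge of \<open>C\<close>,
  those of maximal and of minimal height each carry an orphan. If there are no such vertices, then \<open>C\<close>
  has no free edge, hence is a point or has two free vertices, which are not free in \<open>X\<close>.
\<close>

section \<open>Connectedness and acyclicity through cuts\<close>

definition crosses :: "('v, 'e) pre_digraph \<Rightarrow> 'v set \<Rightarrow> 'e \<Rightarrow> bool" where
  "crosses G S e \<longleftrightarrow> (tail G e \<in> S) \<noteq> (head G e \<in> S)"

definition cut_connected :: "('v, 'e) pre_digraph \<Rightarrow> bool" where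
  "cut_connected G \<longleftrightarrow> verts G \<noteq> {} \<and> (\<forall>S. S \<subset> verts G \<longrightarrow> S \<noteq> {} \<longrightarrow> (\<exists>e \<in> arcs G. crosses G S e))"

text \<open>Every edge is a bridge, witnessed by a vertex set that it alone crosses. Such witnesses
  restrict to subgraphs, and cutting along one of them allows induction without paths.\<close>

definition cut_acyclic :: "('v, 'e) pre_digraph \<Rightarrow> bool" where
  "cut_acyclic G \<longleftrightarrow> (\<forall>e \<in> arcs G. \<exists>S. \<forall>a \<in> arcs G. crosses G S a \<longleftrightarrow> a = e)"

lemma doubled_simps [simp]:
  "verts (doubled G) = verts G"
  "arcs (doubled G) = arcs G \<times> UNIV"
  "tail (doubled G) (a, b) = (if b then tail G a else head G a)"
  "head (doubled G) (a, b) = (if b then head G a else tail G a)"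
  by (simp_all add: doubled_def)

lemma wf_digraph_doubled: "wf_digraph G \<Longrightarrow> wf_digraph (doubled G)"
  by (auto simp: wf_digraph_def split: if_splits)

text \<open>A path that leaves \<open>S\<close> crosses it at some edge; conversely, no edge crosses
  the set of vertices reachable from \<open>u\<close>, so this set is everything.\<close>

lemma connected_iff_cut_connected:
  assumes "wf_digraph G"
  shows "connected G \<longleftrightarrow> cut_connected G"
proof
  assume con: "connected G"
  show "cut_connected G"
    unfolding cut_connected_def
  proof (intro conjI allI impI)
    show "verts G \<noteq> {}" using con by (simp add: connected_conv)
    fix S assume S: "S \<subset> verts G" "S \<noteq> {}"
    then obtain u v where uv: "u \<in> S" "v \<in> verts G" "v \<notin> S" by blast
    then have "(u, v) \<in> rtrancl_on (verts G) ((arcs_ends G)\<^sup>s)"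
      using con S by (auto simp: connected_conv)
    then have "(\<exists>e \<in> arcs G. crosses G S e) \<or> v \<in> S" using uv(1)
    proof (induction rule: rtrancl_on.induct)
      case (rtrancl_on_refl a)
      then show ?case by simp
    next
      case (rtrancl_on_into_rtrancl_on a b c)
      then show ?case by (auto simp: symcl_def arcs_ends_conv crosses_def)
    qed
    then show "\<exists>e \<in> arcs G. crosses G S e" using uv by blast
  qed
next
  assume con: "cut_connected G"
  show "connected G"
    unfolding connected_conv
  proof (intro conjI ballI)
    show "verts G \<noteq> {}" using con by (simp add: cut_connected_def)
    fix u v assume u: "u \<in> verts G" and v: "v \<in> verts G"
    define S where "S = {w. (u, w) \<in> rtrancl_on (verts G) ((arcs_ends G)\<^sup>s)}"
    have "u \<in> S" using u by (simp add: S_def)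
    have "S \<subseteq> verts G" by (auto simp: S_def elim: rtrancl_on.cases)
    have "S = verts G"
    proof (rule ccontr)
      assume "S \<noteq> verts G"
      then obtain e where e: "e \<in> arcs G" "crosses G S e"
        using con \<open>S \<subseteq> verts G\<close> \<open>u \<in> S\<close> unfolding cut_connected_def by blast
      have "tail G e \<in> verts G" "head G e \<in> verts G"
        using assms e by (auto simp: wf_digraph_def)
      moreover have "(tail G e, head G e) \<in> (arcs_ends G)\<^sup>s" "(head G e, tail G e) \<in> (arcs_ends G)\<^sup>s"
        using e(1) by (auto simp: symcl_def arcs_ends_conv)
      ultimately have "tail G e \<in> S \<longleftrightarrow> head G e \<in> S"
        unfolding S_def by (auto intro: rtrancl_on_into_rtrancl_on)
      with e show False by (auto simp: crosses_def)
    qed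
    then show "(u, v) \<in> rtrancl_on (verts G) ((arcs_ends G)\<^sup>s)" using v by (auto simp: S_def)
  qed
qed

text \<open>If an arc recurred in either direction, both of its ends, hence also the start
  \<open>u\<close>, would lie on the rest of the path, which a simple path excludes.\<close>

lemma doubled_apath_distinct:
  assumes "wf_digraph G" "pre_digraph.apath (doubled G) u p v"
  shows "distinct (map fst p)"
  using assms(2)
proof (induction p arbitrary: u)
  case Nil
  then show ?case by simp
next
  case (Cons d q)
  interpret D: wf_digraph "doubled G" by (rule wf_digraph_doubled[OF assms(1)])
  obtain a b where d: "d = (a, b)" by fastforce
  have q: "D.apath (head (doubled G) d) q v" and nin: "u \<notin> set (D.awalk_verts (head (doubled G) d) q)"
    and tl: "tail (doubled G) d = u"
    using Cons.prems by (auto simp: D.apath_def D.awalk_Cons_iff)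
  have "a \<notin> fst ` set q"
  proof
    assume "a \<in> fst ` set q"
    then obtain b' where b': "(a, b') \<in> set q" by force
    then have "tail (doubled G) (a, b') \<in> set (D.awalk_verts (head (doubled G) d) q)"
      "head (doubled G) (a, b') \<in> set (D.awalk_verts (head (doubled G) d) q)"
      using q by (auto simp: D.apath_def D.set_awalk_verts simp del: doubled_simps)
    with nin tl d show False by (auto split: if_splits)
  qed
  with Cons.IH[OF q] d show ?case by simp
qed

text \<open>Delete \<open>e\<close> and take for \<open>S\<close> what its head still reaches. If
  \<open>S\<close> contained the tail of \<open>e\<close>, a simple path back would close up with
  \<open>e\<close> to a cycle.\<close>

lemma undirected_tree_cut_acyclic:
  assumes wf: "wf_digraph G" and tree: "undirected_tree G"
  shows "cut_acyclic G"
  unfolding cut_acyclic_def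
proof
  fix e assume e: "e \<in> arcs G"
  interpret D: wf_digraph "doubled G" by (rule wf_digraph_doubled[OF wf])
  define H where "H = G\<lparr>arcs := arcs G - {e}\<rparr>"
  have wfH: "wf_digraph H" using wf by (auto simp: H_def wf_digraph_def)
  interpret H: wf_digraph "doubled H" by (rule wf_digraph_doubled[OF wfH])
  have H_simps: "verts H = verts G" "arcs H = arcs G - {e}" "tail H = tail G" "head H = head G"
    by (simp_all add: H_def)
  have wfH2: "tail G a \<in> verts G" "head G a \<in> verts G" if "a \<in> arcs G" for a
    using wf that by (auto simp: wf_digraph_def)
  have HG: "tail (doubled H) = tail (doubled G)" "head (doubled H) = head (doubled G)"
    by (auto simp: H_def doubled_def)
  have cas: "H.cas u p v = D.cas u p v" for u p v
    by (induction p arbitrary: u) (auto simp: HG)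
  have av: "H.awalk_verts u p = D.awalk_verts u p" for u p
    by (induction p arbitrary: u) (auto simp: HG)
  define S where "S = {w. \<exists>p. H.awalk (head G e) p w}"
  have hv: "head G e \<in> verts G" "tail G e \<in> verts G" using wf e by (auto simp: wf_digraph_def)
  have hS: "head G e \<in> S"
  proof -
    have "H.awalk (head G e) [] (head G e)"
      unfolding H.awalk_Nil_iff using hv by (simp add: H_def)
    then show ?thesis by (auto simp: S_def)
  qed
  have tS: "tail G e \<notin> S"
  proof
    assume "tail G e \<in> S"
    then obtain p where "H.awalk (head G e) p (tail G e)" by (auto simp: S_def)
    then obtain r where p: "H.apath (head G e) r (tail G e)" by (metis H.apath_awalk_to_apath)
    have arcsH: "arcs H = arcs G - {e}" by (simp add: H_def)
    have r: "set r \<subseteq> (arcs G - {e}) \<times> UNIV" "D.cas (head G e) r (tail G e)"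
      "distinct (D.awalk_verts (head G e) r)"
      using p by (auto simp: H.apath_def H.awalk_def cas av arcsH)
    define q where "q = (e, True) # r"
    have "D.cycle q"
      unfolding D.cycle_def
      using r e hv by (auto simp: q_def D.awalk_def intro!: exI[of _ "tail G e"])
    moreover have "distinct (map fst q)"
      using doubled_apath_distinct[OF wfH p] r(1) by (auto simp: q_def)
    ultimately show False using tree by (auto simp: undirected_tree_def undirected_cycle_def)
  qed
  show "\<exists>S. \<forall>a\<in>arcs G. crosses G S a = (a = e)"
  proof (intro exI[of _ S] ballI iffI)
    fix a assume a: "a \<in> arcs G" "crosses G S a"
    show "a = e"
    proof (rule ccontr)
      assume ne: "a \<noteq> e"
      have step: "tail (doubled G) d \<in> S \<Longrightarrow> head (doubled G) d \<in> S" if "fst d = a" for d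
      proof -
        assume "tail (doubled G) d \<in> S"
        then obtain p where "H.awalk (head G e) p (tail (doubled G) d)" by (auto simp: S_def)
        then have "H.awalk (head G e) (p @ [d]) (head (doubled G) d)"
          using that a ne wfH wfH2
          by (cases d) (auto simp: H.awalk_append_iff H.awalk_Cons_iff H.awalk_Nil_iff H_simps)
        then show "head (doubled G) d \<in> S" by (auto simp: S_def simp del: H.awalk_append_iff)
      qed
      show False using step[of "(a, True)"] step[of "(a, False)"] a by (auto simp: crosses_def)
    qed
  qed (use hS tS in \<open>auto simp: crosses_def\<close>)
qed

text \<open>The bound on the number of edges of a forest, for arbitrary parts \<open>V\<close> and
  \<open>E\<close> of it: the cut belonging to one edge of \<open>E\<close> splits \<open>V\<close>
  into two smaller nonempty sets, and every other edge of \<open>E\<close> lies on one side.\<close>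

lemma cut_acyclic_card:
  assumes "finite V" "V \<noteq> {}" "finite E"
    and "\<And>e. e \<in> E \<Longrightarrow> e \<in> arcs G \<and> tail G e \<in> V \<and> head G e \<in> V"
    and "cut_acyclic G"
  shows "card E < card V"
  using assms(1-4)
proof (induction "card V" arbitrary: V E rule: less_induct)
  case less
  show ?case
  proof (cases "E = {}")
    case True
    then show ?thesis using less.prems by (simp add: card_gt_0_iff)
  next
    case False
    then obtain e where e: "e \<in> E" by blast
    obtain S where S: "\<forall>a \<in> arcs G. crosses G S a \<longleftrightarrow> a = e"
      using less.prems(4)[OF e] assms(5) by (auto simp: cut_acyclic_def)
    have eS: "crosses G S e" using S e less.prems(4) by blast
    define E1 E2 where "E1 = {a \<in> E. tail G a \<in> S \<and> head G a \<in> S}"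
      and "E2 = {a \<in> E. tail G a \<notin> S \<and> head G a \<notin> S}"
    have ne: "V \<inter> S \<noteq> {}" "V - S \<noteq> {}" using eS less.prems(4)[OF e] by (auto simp: crosses_def)
    have c: "card V = card (V \<inter> S) + card (V - S)"
      using less.prems(1) by (metis card_Int_Diff)
    have "card (V \<inter> S) > 0" "card (V - S) > 0" using ne less.prems(1) by (auto simp: card_gt_0_iff)
    then have "card E1 < card (V \<inter> S)" "card E2 < card (V - S)"
      using less.prems ne c by (auto intro!: less.hyps simp: E1_def E2_def)
    moreover have "E = insert e (E1 \<union> E2)"
      using e S less.prems(4) by (auto simp: E1_def E2_def crosses_def)
    then have "card E \<le> Suc (card E1 + card E2)"
      by (metis card_Un_le card_insert_le_m1 card_insert_le Suc_le_mono card_insert_if less.prems(3) finite_Un finite_insert le_SucI)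
    ultimately show ?thesis using c by linarith
  qed
qed

text \<open>If no edge crossed \<open>S\<close>, the forest bound on both sides of \<open>S\<close>
  would leave at most \<open>card (verts G) - 2\<close> edges.\<close>

lemma cut_acyclic_card_connected:
  assumes "finite (verts G)" "verts G \<noteq> {}" "wf_digraph G" "finite (arcs G)" "cut_acyclic G"
    and "card (verts G) \<le> Suc (card (arcs G))"
  shows "cut_connected G"
  unfolding cut_connected_def
proof (intro conjI allI impI)
  fix S assume S: "S \<subset> verts G" "S \<noteq> {}"
  show "\<exists>e\<in>arcs G. crosses G S e"
  proof (rule ccontr)
    assume no: "\<not> (\<exists>e\<in>arcs G. crosses G S e)"
    let ?A = "{e \<in> arcs G. tail G e \<in> S}" and ?B = "{e \<in> arcs G. tail G e \<notin> S}"
    have "card ?A < card S"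
      using assms S no finite_subset[of S "verts G"]
      by (intro cut_acyclic_card[where G = G]) (auto simp: crosses_def)
    moreover have "card ?B < card (verts G - S)"
      using assms S no
      by (intro cut_acyclic_card[where G = G]) (auto simp: crosses_def wf_digraph_def)
    moreover have "card (verts G - S) = card (verts G) - card S"
      using S assms(1) by (intro card_Diff_subset) (auto intro: finite_subset)
    moreover have "card S \<le> card (verts G)" using S assms(1) by (intro card_mono) auto
    moreover have "card (arcs G) = card (?A \<union> ?B)" by (rule arg_cong[of _ _ card]) auto
    then have "card (arcs G) = card ?A + card ?B"
      using assms(4) by (simp add: card_Un_disjoint disjoint_iff)
    ultimately show False using assms(6) by linarith
  qed
qed (use assms in auto)

text \<open>The tree is grown from \<open>y\<close> one edge at a time along cuts. \<open>ch\<close>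
  and \<open>pa\<close> are the child and parent ends of a tree edge; a new vertex gets a rank one
  above that of its parent.\<close>

lemma rooted_spanning_tree:
  assumes "fin_digraph G" "cut_connected G" "y \<in> verts G"
  obtains F ch pa and rk :: "'v \<Rightarrow> nat" where "F \<subseteq> arcs G" "bij_betw ch F (verts G - {y})"
    "\<And>e. e \<in> F \<Longrightarrow> (ch e, pa e) \<in> {(tail G e, head G e), (head G e, tail G e)}"
    "\<And>e. e \<in> F \<Longrightarrow> rk (pa e) < rk (ch e)"
proof -
  interpret fin_digraph G by fact
  define good where "good U F ch pa rk \<longleftrightarrow> y \<in> U \<and> U \<subseteq> verts G \<and> F \<subseteq> arcs G \<and> bij_betw ch F (U - {y}) \<and>
    (\<forall>e \<in> F. (ch e, pa e) \<in> {(tail G e, head G e), (head G e, tail G e)} \<and> pa e \<in> U \<and> rk (pa e) < rk (ch e))"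
    for U and F and ch pa and rk :: "'v \<Rightarrow> nat"
  have "\<exists>U F ch pa rk. good U F ch pa rk \<and> card U = Suc n" if "n < card (verts G)" for n
    using that
  proof (induction n)
    case 0
    show ?case
      by (intro exI[of _ "{y}"] exI[of _ "{}"]) (use assms(3) in \<open>auto simp: good_def bij_betw_def\<close>)
  next
    case (Suc n)
    then obtain U F ch pa rk where g: "good U F ch pa rk" and U: "card U = Suc n" by auto
    have "finite U" using g finite_subset unfolding good_def by (metis finite_verts)
    have "U \<subset> verts G" "U \<noteq> {}" using g U Suc.prems by (auto simp: good_def)
    then obtain e where e: "e \<in> arcs G" "crosses G U e" using assms(2) by (auto simp: cut_connected_def)
    define x where "x = (if tail G e \<in> U then head G e else tail G e)"
    define z where "z = (if tail G e \<in> U then tail G e else head G e)"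
    have xz: "x \<notin> U" "z \<in> U" "x \<in> verts G" "(x, z) \<in> {(tail G e, head G e), (head G e, tail G e)}"
      using e by (auto simp: x_def z_def crosses_def)
    have ends: "tail G a \<in> U" "head G a \<in> U" "ch a \<in> U" "pa a \<in> U" if "a \<in> F" for a
    proof -
      show c: "ch a \<in> U" and p: "pa a \<in> U" using g that unfolding good_def bij_betw_def by auto
      have "(ch a, pa a) \<in> {(tail G a, head G a), (head G a, tail G a)}"
        using g that unfolding good_def by blast
      then show "tail G a \<in> U" "head G a \<in> U" using c p by auto
    qed
    have eF: "e \<notin> F" using ends e by (auto simp: crosses_def)
    have chx: "ch a \<noteq> x" "pa a \<noteq> x" if "a \<in> F" for a using ends[OF that] xz by auto
    have img: "ch ` F = U - {y}" and inj: "inj_on ch F" using g by (auto simp: good_def bij_betw_def)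
    have im: "(ch(e := x)) ` insert e F = insert x U - {y}"
    proof -
      have "(ch(e := x)) ` F = ch ` F" using eF by (intro image_cong) auto
      moreover have "x \<noteq> y" using xz g by (auto simp: good_def)
      ultimately show ?thesis using img by auto
    qed
    have ij: "inj_on (ch(e := x)) (insert e F)"
      using inj chx eF by (auto simp: inj_on_def)
    have "good (insert x U) (insert e F) (ch(e := x)) (pa(e := z)) (rk(x := Suc (rk z)))"
      unfolding good_def
    proof (intro conjI ballI)
      show "bij_betw (ch(e := x)) (insert e F) (insert x U - {y})" using im ij by (simp add: bij_betw_def)
      show "((ch(e := x)) a, (pa(e := z)) a) \<in> {(tail G a, head G a), (head G a, tail G a)}"
        if "a \<in> insert e F" for a
        using that xz g by (auto simp: good_def)
      show "(rk(x := Suc (rk z))) ((pa(e := z)) a) < (rk(x := Suc (rk z))) ((ch(e := x)) a)"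
        if "a \<in> insert e F" for a
        using that xz chx g by (auto simp: good_def)
    qed (use g xz e in \<open>auto simp: good_def\<close>)
    then show ?case using U xz \<open>finite U\<close> by (intro exI conjI) auto
  qed
  moreover have "card (verts G) > 0" using assms(3) by (auto simp: card_gt_0_iff)
  ultimately obtain U F ch pa rk where g: "good U F ch pa rk" and U: "card U = card (verts G)"
    using Suc_pred[of "card (verts G)"] lessI by metis
  have "U \<subseteq> verts G" using g by (simp add: good_def)
  then have "U = verts G" using U by (intro card_subset_eq) simp_all
  then show ?thesis using g that[of F ch pa rk] unfolding good_def by blast
qed

text \<open>A spanning tree gives at least, and the forest bound at most,
  \<open>card (verts G) - 1\<close> edges.\<close>

lemma tree_card:
  assumes "fin_digraph G" "undirected_tree G"
  shows "card (verts G) = Suc (card (arcs G))"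
proof -
  interpret fin_digraph G by fact
  have con: "cut_connected G"
    using assms(2) connected_iff_cut_connected[OF wf_digraph] by (simp add: undirected_tree_def)
  then obtain y where y: "y \<in> verts G" by (auto simp: cut_connected_def)
  from rooted_spanning_tree[OF assms(1) con this] obtain F ch
    where F: "F \<subseteq> arcs G" "bij_betw ch F (verts G - {y})" by metis
  have "card F = card (verts G) - 1" using F(2) y by (simp add: bij_betw_same_card)
  moreover have "card F \<le> card (arcs G)" using F(1) by (intro card_mono) auto
  moreover have "card (arcs G) < card (verts G)"
    using y undirected_tree_cut_acyclic[OF wf_digraph assms(2)]
    by (intro cut_acyclic_card[where G = G]) auto
  ultimately show ?thesis by linarith
qed

text \<open>By the edge count a spanning tree already uses every arc, so any vertex may serve as the
  root of the whole graph.\<close>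

lemma rooted_tree:
  assumes "fin_digraph G" "cut_connected G" "y \<in> verts G" "card (verts G) = Suc (card (arcs G))"
  obtains ch pa and rk :: "'v \<Rightarrow> nat" where "bij_betw ch (arcs G) (verts G - {y})"
    "\<And>e. e \<in> arcs G \<Longrightarrow> (ch e, pa e) \<in> {(tail G e, head G e), (head G e, tail G e)}"
    "\<And>e. e \<in> arcs G \<Longrightarrow> rk (pa e) < rk (ch e)"
proof -
  interpret fin_digraph G by fact
  obtain F ch pa and rk :: "'v \<Rightarrow> nat" where F: "F \<subseteq> arcs G" "bij_betw ch F (verts G - {y})"
    and r: "\<And>e. e \<in> F \<Longrightarrow> (ch e, pa e) \<in> {(tail G e, head G e), (head G e, tail G e)}"
    "\<And>e. e \<in> F \<Longrightarrow> rk (pa e) < rk (ch e)"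
    by (rule rooted_spanning_tree[OF assms(1-3)]) blast
  have "card F = card (arcs G)" using bij_betw_same_card[OF F(2)] assms(3,4) by simp
  with F(1) have "F = arcs G" by (intro card_subset_eq) auto
  with F r that show ?thesis by blast
qed

section \<open>Two edge-disjoint arborescences\<close>

text \<open>
  Edmonds' theorem for two arborescences and all out-degrees two, by Lovasz's argument: the first
  arborescence is grown so that the remaining arrows still leave every set. The next arrow is taken
  inside a minimal set \<open>A\<close> that only one remaining arrow leaves; submodularity shows that it is not
  the last arrow leaving any other set.
\<close>

lemma two_arborescences:
  fixes g :: "'v \<Rightarrow> bool \<Rightarrow> 'v"
  assumes fin: "finite W"
    and cut: "\<And>S. S \<subseteq> W \<Longrightarrow> S \<noteq> {} \<Longrightarrow> 2 \<le> card {(x, i). x \<in> S \<and> g x i \<notin> S}"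
  obtains \<sigma> where "\<And>S. S \<subseteq> W \<Longrightarrow> S \<noteq> {} \<Longrightarrow> \<exists>x \<in> S. g x (\<sigma> x) \<notin> S"
    "\<And>S. S \<subseteq> W \<Longrightarrow> S \<noteq> {} \<Longrightarrow> \<exists>x \<in> S. g x (\<not> \<sigma> x) \<notin> S"
proof -
  define out where "out U \<sigma> S = {(x, i). x \<in> S \<and> g x i \<notin> S \<and> \<not> (x \<in> U \<and> i = \<sigma> x)}" for U \<sigma> S
  \<comment> \<open>The last clause says that used arrows end in \<open>U\<close> or outside
    \<open>W\<close>, where the arborescences are rooted.\<close>
  define good where "good U \<sigma> \<longleftrightarrow> U \<subseteq> W \<and> (\<forall>S \<subseteq> W. S \<noteq> {} \<longrightarrow> out U \<sigma> S \<noteq> {}) \<and>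
    (\<forall>S \<subseteq> U. S \<noteq> {} \<longrightarrow> (\<exists>x \<in> S. g x (\<sigma> x) \<notin> S)) \<and> (\<forall>x \<in> U. g x (\<sigma> x) \<notin> W - U)" for U \<sigma>
  have fin_out: "finite (out U \<sigma> S)" if "S \<subseteq> W" for U \<sigma> S
    by (rule finite_subset[of _ "S \<times> UNIV"]) (use finite_subset[OF that fin] in \<open>auto simp: out_def\<close>)
  have step: "\<exists>x \<sigma>'. x \<in> W - U \<and> good (insert x U) \<sigma>'" if g: "good U \<sigma>" and W: "W - U \<noteq> {}" for U \<sigma>
  proof -
    have out1: "out U \<sigma> S \<noteq> {}" if "S \<subseteq> W" "S \<noteq> {}" for S using g that by (auto simp: good_def)
    have out_new: "out U \<sigma> S = {(x, i). x \<in> S \<and> g x i \<notin> S}" if "S \<subseteq> W - U" for S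
      using that by (auto simp: out_def)
    define tight where "tight A \<longleftrightarrow> A \<subseteq> W \<and> A - U \<noteq> {} \<and> card (out U \<sigma> A) = 1" for A
    obtain x i where x: "x \<in> W - U" "g x i \<notin> W - U"
      and nt: "\<And>S. S \<subseteq> W \<Longrightarrow> x \<in> S \<Longrightarrow> g x i \<notin> S \<Longrightarrow> \<not> tight S"
    proof (cases "\<exists>A. tight A")
      case False
      have "card {(x, i). x \<in> W - U \<and> g x i \<notin> W - U} \<ge> 2" using cut[of "W - U"] W by auto
      then have "{(x, i). x \<in> W - U \<and> g x i \<notin> W - U} \<noteq> {}" by (metis card.empty not_numeral_le_zero)
      then show thesis using False that by blast
    next
      case True
      define A where "A = arg_min card tight"
      have A: "tight A" "\<And>B. tight B \<Longrightarrow> card A \<le> card B"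
        using True arg_min_nat_lemma[of tight _ card] unfolding A_def by blast+
      have AW: "A \<subseteq> W" using A by (simp add: tight_def)
      \<comment> \<open>No arrow of \<open>A - U\<close> has been used, so at least two leave
        \<open>A - U\<close>, while only one leaves \<open>A\<close>. Hence some arrow from
        \<open>A - U\<close> ends in \<open>A \<inter> U\<close>.\<close>
      have "\<not> out U \<sigma> (A - U) \<subseteq> out U \<sigma> A"
      proof
        assume "out U \<sigma> (A - U) \<subseteq> out U \<sigma> A"
        then have "card (out U \<sigma> (A - U)) \<le> 1"
          using A(1) fin_out[OF AW] card_mono unfolding tight_def by metis
        moreover
        have "2 \<le> card (out U \<sigma> (A - U))"
        proof -
          have "A - U \<subseteq> W" "A - U \<noteq> {}" "A - U \<subseteq> W - U" using A(1) by (auto simp: tight_def)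
          then show ?thesis using cut[of "A - U"] out_new[of "A - U"] by simp
        qed
        ultimately show False by simp
      qed
      then obtain x i where x: "x \<in> A - U" "g x i \<in> A" "g x i \<in> U" by (auto simp: out_def)
      have "\<not> tight S" if S: "S \<subseteq> W" "x \<in> S" "g x i \<notin> S" for S
      proof
        assume t: "tight S"
        let ?o = "out U \<sigma>"
        have f: "finite (?o A)" "finite (?o S)" "finite (?o (A \<inter> S))" "finite (?o (A \<union> S))"
          using AW S by (auto intro!: fin_out)
        have "card (?o (A \<inter> S)) + card (?o (A \<union> S))
            = card (?o (A \<inter> S) \<union> ?o (A \<union> S)) + card (?o (A \<inter> S) \<inter> ?o (A \<union> S))"
          using f by (intro card_Un_Int)
        also have "\<dots> \<le> card (?o A \<union> ?o S) + card (?o A \<inter> ?o S)"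
          using f by (intro add_mono card_mono) (auto simp: out_def)
        also have "\<dots> = card (?o A) + card (?o S)" using f by (intro card_Un_Int[symmetric])
        also have "\<dots> = 2" using A(1) t by (simp add: tight_def)
        finally have "card (?o (A \<inter> S)) + card (?o (A \<union> S)) \<le> 2" .
        moreover have "card (?o (A \<inter> S)) > 0" "card (?o (A \<union> S)) > 0"
          using f out1[of "A \<inter> S"] out1[of "A \<union> S"] AW S x by (auto simp: card_gt_0_iff)
        ultimately have "card (?o (A \<inter> S)) = 1" by linarith
        \<comment> \<open>The new tight set still contains \<open>x\<close>, which is outside
          \<open>U\<close>, but misses the end of the arrow, which lies in \<open>A\<close>; this
          contradicts the minimality of \<open>A\<close>.\<close>
        then have "tight (A \<inter> S)" using AW x S by (auto simp: tight_def)
        moreover have "card (A \<inter> S) < card A"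
          using x S AW fin finite_subset by (intro psubset_card_mono) auto
        ultimately show False using A(2)[of "A \<inter> S"] by simp
      qed
      then show thesis using that[of x i] x AW by blast
    qed
    define \<tau> where "\<tau> = \<sigma>(x := i)"
    have "good (insert x U) \<tau>"
      unfolding good_def
    proof (intro conjI allI impI)
      show "insert x U \<subseteq> W" using x g by (auto simp: good_def)
      show "\<forall>z \<in> insert x U. g z (\<tau> z) \<notin> W - insert x U" using x g by (auto simp: good_def \<tau>_def)
    next
      fix S assume S: "S \<subseteq> W" "S \<noteq> {}"
      have sup: "out U \<sigma> S - {(x, i)} \<subseteq> out (insert x U) \<tau> S"
        using x by (auto simp: out_def \<tau>_def split: if_splits)
      show "out (insert x U) \<tau> S \<noteq> {}"
      proof (cases "x \<in> S \<and> g x i \<notin> S")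
        case True
        then have "card (out U \<sigma> S) \<noteq> 1" using nt[OF S(1)] S x by (auto simp: tight_def)
        then have "\<not> out U \<sigma> S \<subseteq> {(x, i)}" using out1[OF S] by (metis One_nat_def card.empty card.insert empty_iff finite.emptyI subset_singletonD)
        then show ?thesis using sup by blast
      next
        case False
        then have "(x, i) \<notin> out U \<sigma> S" by (auto simp: out_def)
        then show ?thesis using out1[OF S] sup by blast
      qed
    next
      fix S assume S: "S \<subseteq> insert x U" "S \<noteq> {}"
      have gU: "\<exists>z \<in> T. g z (\<sigma> z) \<notin> T" if "T \<subseteq> U" "T \<noteq> {}" for T
        using g that unfolding good_def by blast
      have gU2: "g z (\<sigma> z) \<notin> W - U" if "z \<in> U" for z
        using g that unfolding good_def by blast
      show "\<exists>z\<in>S. g z (\<tau> z) \<notin> S"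
      proof (cases "S - {x} = {}")
        case True
        then have "S = {x}" using S by auto
        moreover have "g x i \<noteq> x" using x by auto
        ultimately show ?thesis by (simp add: \<tau>_def)
      next
        case False
        have T: "S - {x} \<subseteq> U" using S by auto
        from gU[OF T False] obtain z where z: "z \<in> S - {x}" "g z (\<sigma> z) \<notin> S - {x}" by blast
        have "g z (\<sigma> z) \<noteq> x" using gU2[of z] z(1) T x by auto
        then have "g z (\<tau> z) \<notin> S" using z by (simp add: \<tau>_def)
        then show ?thesis using z by blast
      qed
    qed
    then show ?thesis using x by blast
  qed
  have "\<exists>U \<sigma>. good U \<sigma> \<and> card (W - U) \<le> card W - n" for n
  proof (induction n)
    case 0
    have "good {} (\<lambda>_. True)"
      unfolding good_def
    proof (intro conjI allI impI)
      fix S assume "S \<subseteq> W" "S \<noteq> {}"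
      then have "{(x, i). x \<in> S \<and> g x i \<notin> S} \<noteq> {}" using cut[of S] by (metis card.empty not_numeral_le_zero)
      then show "out {} (\<lambda>_. True) S \<noteq> {}" by (simp add: out_def)
    qed auto
    then show ?case by (intro exI[of _ "{}"] exI[of _ "\<lambda>_. True"]) auto
  next
    case (Suc n)
    then obtain U \<sigma> where U: "good U \<sigma>" "card (W - U) \<le> card W - n" by blast
    show ?case
    proof (cases "W - U = {}")
      case True
      then show ?thesis using U by (metis card.empty le0)
    next
      case False
      from step[OF U(1) this] obtain x \<sigma>' where x: "x \<in> W - U" "good (insert x U) \<sigma>'" by blast
      have "card (W - insert x U) < card (W - U)" using x fin by (intro psubset_card_mono) auto
      then show ?thesis using U x by (intro exI[of _ "insert x U"] exI[of _ \<sigma>']) auto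
    qed
  qed
  from this[of "card W"] obtain U \<sigma> where U: "good U \<sigma>" "card (W - U) = 0" by auto
  then have "U = W" using fin by (auto simp: good_def)
  show thesis
  proof (rule that)
    fix S assume S: "S \<subseteq> W" "S \<noteq> {}"
    show "\<exists>x\<in>S. g x (\<sigma> x) \<notin> S" using U(1) S unfolding \<open>U = W\<close> good_def by blast
    have "out W \<sigma> S \<noteq> {}" using U(1) S unfolding \<open>U = W\<close> good_def by blast
    then obtain x i where xi: "x \<in> S" "g x i \<notin> S" "i \<noteq> \<sigma> x" using S by (auto simp: out_def)
    then have "i = (\<not> \<sigma> x)" by auto
    with xi show "\<exists>x\<in>S. g x (\<not> \<sigma> x) \<notin> S" by blast
  qed
qed

section \<open>The two label trees of a LOT\<close>

lemma subgraph_undirected_cycle: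
  assumes "subgraph H G" "undirected_cycle H p"
  shows "undirected_cycle G p"
proof -
  have eq: "tail (doubled H) = tail (doubled G)" "head (doubled H) = head (doubled G)"
    using assms(1) by (auto simp: subgraph_def compatible_def doubled_def)
  have cas: "pre_digraph.cas (doubled H) u q v = pre_digraph.cas (doubled G) u q v" for u q v
    by (induction q arbitrary: u) (simp_all add: pre_digraph.cas.simps eq)
  have av: "pre_digraph.awalk_verts (doubled H) u q = pre_digraph.awalk_verts (doubled G) u q" for u q
    by (induction q arbitrary: u) (simp_all add: pre_digraph.awalk_verts.simps eq)
  have sub: "verts H \<subseteq> verts G" "arcs H \<subseteq> arcs G" using assms(1) by (auto simp: subgraph_def)
  show ?thesis
    using assms(2) sub
    unfolding undirected_cycle_def pre_digraph.cycle_def pre_digraph.awalk_def cas av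
    by fastforce
qed

abbreviation arc_end :: "('v, 'e) pre_digraph \<Rightarrow> 'e \<Rightarrow> bool \<Rightarrow> 'v" where
  "arc_end G e b \<equiv> tail (doubled G) (e, b)"

text \<open>By injectivity the set \<open>E\<close> of edges labeled by \<open>S\<close> has as many
  elements as \<open>S\<close>. If no arrow leaves \<open>S\<close>, then \<open>E\<close> is a
  forest on \<open>S\<close> with too many edges. If a single one leaves \<open>S\<close>, ending at
  \<open>z\<close>, then the edge count makes \<open>E\<close> a tree on \<open>insert z S\<close>:
  a sub-LOT in which \<open>z\<close> has valency 1 and is not a label.\<close>

lemma sub_LOT_cut:
  assumes D: "LOT D" and inj: "injective_LOG D"
    and nobr: "\<not> (\<exists>\<Delta>. sub_LOT \<Delta> D \<and> boundary_reducible \<Delta>)"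
    and S: "S \<subseteq> label D ` arcs (ugraph D)" "S \<noteq> {}"
  shows "2 \<le> card {(e, i). e \<in> arcs (ugraph D) \<and> label D e \<in> S \<and> arc_end (ugraph D) e i \<notin> S}"
    (is "2 \<le> card ?P")
proof (rule ccontr)
  assume small: "\<not> 2 \<le> card ?P"
  let ?G = "ugraph D"
  interpret fin_digraph ?G using D by (simp add: LOT_def LOG_def)
  have acyc: "cut_acyclic ?G" using D undirected_tree_cut_acyclic[OF wf_digraph] by (simp add: LOT_def)
  define E where "E = {e \<in> arcs ?G. label D e \<in> S}"
  have SV: "S \<subseteq> verts ?G" using S D by (auto simp: LOT_def LOG_def)
  have fin: "finite S" "finite E" using finite_subset[OF SV] by (auto simp: E_def)
  have "bij_betw (label D) E S"
    using inj S by (auto simp: bij_betw_def E_def injective_LOG_def inj_on_def)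
  then have cE: "card E = card S" by (rule bij_betw_same_card)
  have finP: "finite ?P" by (rule finite_subset[of _ "E \<times> UNIV"]) (use fin in \<open>auto simp: E_def\<close>)
  show False
  proof (cases "?P = {}")
    case True
    have "tail ?G e \<in> S \<and> head ?G e \<in> S" if "e \<in> E" for e
      using that equals0D[OF True, of "(e, True)"] equals0D[OF True, of "(e, False)"] by (simp add: E_def)
    then have "card E < card S"
      using fin S acyc by (intro cut_acyclic_card[where G = ?G]) (auto simp: E_def)
    then show False using cE by simp
  next
    case False
    then have "card ?P = 1" using small finP by (simp add: card_gt_0_iff less_Suc_eq_le Suc_leI le_antisym not_le numeral_2_eq_2)
    then obtain d0 where "?P = {d0}" by (auto simp: card_1_singleton_iff)
    moreover obtain e0 i0 where "d0 = (e0, i0)" by fastforce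
    ultimately have P: "?P = {(e0, i0)}" by simp
    define z where "z = arc_end ?G e0 i0"
    have "(e0, i0) \<in> ?P" unfolding P by simp
    then have e0: "e0 \<in> arcs ?G" "label D e0 \<in> S" "z \<notin> S" by (simp_all add: z_def)
    have zV: "z \<in> verts ?G" using e0 by (auto simp: z_def)
    have ends: "arc_end ?G e i \<in> S \<or> (e = e0 \<and> i = i0)" if "e \<in> E" for e i
    proof (rule ccontr)
      assume n: "\<not> ?thesis"
      then have "(e, i) \<in> ?P" using that by (simp add: E_def)
      then show False using n unfolding P by simp
    qed
    define \<Delta> where "\<Delta> = D\<lparr>ugraph := ?G\<lparr>verts := insert z S, arcs := E\<rparr>\<rparr>"
    have \<Delta>: "verts (ugraph \<Delta>) = insert z S" "arcs (ugraph \<Delta>) = E" "tail (ugraph \<Delta>) = tail ?G"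
      "head (ugraph \<Delta>) = head ?G" "label \<Delta> = label D"
      by (simp_all add: \<Delta>_def)
    have wf: "wf_digraph (ugraph \<Delta>)"
    proof
      fix e assume "e \<in> arcs (ugraph \<Delta>)"
      then show "tail (ugraph \<Delta>) e \<in> verts (ugraph \<Delta>)" "head (ugraph \<Delta>) e \<in> verts (ugraph \<Delta>)"
        using ends[of e True] ends[of e False] by (auto simp: \<Delta> z_def)
    qed
    have sub: "subgraph (ugraph \<Delta>) ?G"
      using wf SV zV by (auto simp: subgraph_def compatible_def \<Delta> E_def wf_digraph)
    have "cut_acyclic (ugraph \<Delta>)"
      unfolding cut_acyclic_def \<Delta>(2)
    proof
      fix e assume "e \<in> E"
      then obtain T where "\<forall>a \<in> arcs ?G. crosses ?G T a \<longleftrightarrow> a = e"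
        using acyc by (auto simp: cut_acyclic_def E_def)
      then show "\<exists>S. \<forall>a\<in>E. crosses (ugraph \<Delta>) S a = (a = e)"
        by (intro exI[of _ T]) (auto simp: E_def crosses_def \<Delta>)
    qed
    then have "cut_connected (ugraph \<Delta>)"
      using wf fin e0 cE by (intro cut_acyclic_card_connected) (auto simp: \<Delta>)
    then have "undirected_tree (ugraph \<Delta>)"
      using D connected_iff_cut_connected[OF wf] subgraph_undirected_cycle[OF sub]
      by (auto simp: undirected_tree_def LOT_def)
    then have "sub_LOT \<Delta> D"
      using sub e0 by (auto simp: sub_LOT_def \<Delta> E_def)
    moreover have "boundary_reducible \<Delta>"
    proof -
      have st: "(e, b) \<in> star (ugraph \<Delta>) z \<longleftrightarrow> e \<in> E \<and> arc_end ?G e b = z" for e b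
        by (auto simp: star_def out_arcs_def \<Delta>)
      have "star (ugraph \<Delta>) z = {(e0, i0)}"
      proof (intro equalityI subsetI)
        fix d assume d: "d \<in> star (ugraph \<Delta>) z"
        obtain e b where "d = (e, b)" by fastforce
        with d st[of e b] ends[of e b] e0(3) show "d \<in> {(e0, i0)}" by auto
      next
        fix d assume "d \<in> {(e0, i0)}"
        then show "d \<in> star (ugraph \<Delta>) z" using st[of e0 i0] e0 by (simp add: z_def E_def)
      qed
      then have "valency (ugraph \<Delta>) z = 1" by (simp add: valency_def)
      moreover have "z \<noteq> label D e" if "e \<in> E" for e using that e0 by (auto simp: E_def)
      ultimately show ?thesis by (auto simp: boundary_reduced_def \<Delta>)
    qed
    ultimately show False using nobr by blast
  qed
qed

text \<open>For each \<open>c\<close>, replace every edge by the arrow from its label that belongs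
  to the arborescence \<open>c\<close>. The resulting graph is connected with one edge less than
  vertices, so it is a tree and may be rooted at \<open>y\<close> instead of the non-label.\<close>

lemma label_trees:
  assumes D: "LOT D" and inj: "injective_LOG D"
    and nobr: "\<not> (\<exists>\<Delta>. sub_LOT \<Delta> D \<and> boundary_reducible \<Delta>)"
    and y: "y \<in> verts (ugraph D)"
  obtains \<sigma> :: "'v \<Rightarrow> bool" and ch pa :: "bool \<Rightarrow> 'e \<Rightarrow> 'v" and rk :: "bool \<Rightarrow> 'v \<Rightarrow> nat" where
    "\<And>c. bij_betw (ch c) (arcs (ugraph D)) (verts (ugraph D) - {y})"
    "\<And>c e. e \<in> arcs (ugraph D) \<Longrightarrow>
       (ch c e, pa c e) \<in> {(label D e, arc_end (ugraph D) e (\<sigma> (label D e) = c)),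
                          (arc_end (ugraph D) e (\<sigma> (label D e) = c), label D e)}"
    "\<And>c e. e \<in> arcs (ugraph D) \<Longrightarrow> rk c (pa c e) < rk c (ch c e)"
proof -
  let ?G = "ugraph D" and ?l = "label D"
  interpret fin_digraph ?G using D by (simp add: LOT_def LOG_def)
  define W where "W = ?l ` arcs ?G"
  have inj': "inj_on ?l (arcs ?G)" using inj by (simp add: injective_LOG_def)
  have WV: "W \<subseteq> verts ?G" using D by (auto simp: W_def LOT_def LOG_def)
  have card: "card (verts ?G) = Suc (card (arcs ?G))"
    using D by (intro tree_card fin_digraph) (simp add: LOT_def)
  have "card W = card (arcs ?G)" unfolding W_def by (rule card_image[OF inj'])
  then have "card (verts ?G - W) = 1" using card WV by (simp add: card_Diff_subset finite_subset)
  \<comment> \<open>Labels are distinct and number one less than the vertices, so exactly one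
    vertex, \<open>v0\<close>, is no label.\<close>
  then obtain v0 where v0: "verts ?G - W = {v0}" by (auto simp: card_1_singleton_iff)
  define edge where "edge = inv_into (arcs ?G) ?l"
  have edge: "edge x \<in> arcs ?G" "?l (edge x) = x" if "x \<in> W" for x
    using that by (auto simp: edge_def W_def f_inv_into_f inv_into_into)
  have edge_l: "edge (?l e) = e" if "e \<in> arcs ?G" for e
    using that inj' by (simp add: edge_def)
  define g where "g x b = arc_end ?G (edge x) b" for x b
  have cut: "2 \<le> card {(x, i). x \<in> S \<and> g x i \<notin> S}" if S: "S \<subseteq> W" "S \<noteq> {}" for S
  proof -
    have "bij_betw (map_prod ?l id) {(e, i). e \<in> arcs ?G \<and> ?l e \<in> S \<and> arc_end ?G e i \<notin> S}
        {(x, i). x \<in> S \<and> g x i \<notin> S}"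
      by (rule bij_betw_byWitness[where f' = "map_prod edge id"])
        (use S edge edge_l in \<open>auto simp: g_def subset_iff split: if_splits\<close>)
    from bij_betw_same_card[OF this] show ?thesis
      using sub_LOT_cut[OF D inj nobr, of S] S by (simp add: W_def)
  qed
  obtain \<sigma> where s1: "\<And>S. S \<subseteq> W \<Longrightarrow> S \<noteq> {} \<Longrightarrow> \<exists>x \<in> S. g x (\<sigma> x) \<notin> S"
    and s2: "\<And>S. S \<subseteq> W \<Longrightarrow> S \<noteq> {} \<Longrightarrow> \<exists>x \<in> S. g x (\<not> \<sigma> x) \<notin> S"
    using two_arborescences[OF finite_subset[OF WV finite_verts] cut] by blast
  have leave: "\<exists>x \<in> S. g x (\<sigma> x = c) \<notin> S" if "S \<subseteq> W" "S \<noteq> {}" for S c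
    using s1[OF that] s2[OF that] by (cases c) auto
  define T where "T c = \<lparr>verts = verts ?G, arcs = arcs ?G, tail = ?l,
    head = (\<lambda>e. arc_end ?G e (\<sigma> (?l e) = c))\<rparr>" for c
  have T: "fin_digraph (T c)" for c
    using WV by unfold_locales (auto simp: T_def W_def)
  have con: "cut_connected (T c)" for c
    unfolding cut_connected_def
  proof (intro conjI allI impI)
    show "verts (T c) \<noteq> {}" using y by (auto simp: T_def)
    fix S assume S: "S \<subset> verts (T c)" "S \<noteq> {}"
    \<comment> \<open>Arrows are known to leave only sets that avoid \<open>v0\<close>; since
      crossing ignores directions, \<open>S\<close> may be replaced by its complement.\<close>
    define S' where "S' = (if v0 \<in> S then verts ?G - S else S)"
    have "S' \<subseteq> W" "S' \<noteq> {}" using S v0 by (auto simp: S'_def T_def)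
    from leave[OF this, of c] obtain x where x: "x \<in> S'" "g x (\<sigma> x = c) \<notin> S'" by blast
    have e: "edge x \<in> arcs ?G" "?l (edge x) = x" using edge[of x] \<open>S' \<subseteq> W\<close> x by auto
    have "g x (\<sigma> x = c) \<in> verts ?G" using e by (auto simp: g_def)
    then have "crosses (T c) S (edge x)"
      using x e S by (auto simp: crosses_def T_def S'_def g_def split: if_splits)
    then show "\<exists>e\<in>arcs (T c). crosses (T c) S e" using e by (auto simp: T_def)
  qed
  have "\<exists>ch pa. \<exists>rk :: 'v \<Rightarrow> nat. bij_betw ch (arcs ?G) (verts ?G - {y}) \<and>
    (\<forall>e \<in> arcs ?G. (ch e, pa e) \<in> {(?l e, arc_end ?G e (\<sigma> (?l e) = c)), (arc_end ?G e (\<sigma> (?l e) = c), ?l e)}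
      \<and> rk (pa e) < rk (ch e))" for c
  proof -
    have "y \<in> verts (T c)" "card (verts (T c)) = Suc (card (arcs (T c)))"
      using y card by (simp_all add: T_def)
    then obtain ch pa and rk :: "'v \<Rightarrow> nat" where "bij_betw ch (arcs (T c)) (verts (T c) - {y})"
      "\<And>e. e \<in> arcs (T c) \<Longrightarrow>
         (ch e, pa e) \<in> {(tail (T c) e, head (T c) e), (head (T c) e, tail (T c) e)}"
      "\<And>e. e \<in> arcs (T c) \<Longrightarrow> rk (pa e) < rk (ch e)"
      using rooted_tree[OF T con, of y c] by metis
    then show ?thesis
      unfolding T_def by (intro exI[of _ ch] exI[of _ pa] exI[of _ rk]) simp
  qed
  then show thesis using that by metis
qed

section \<open>Immersions into LOG complexes\<close>

lemma inv_dart_inv_dart [simp]: "inv_dart (inv_dart d) = d"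
  by (cases d) auto

lemma fst_inv_dart [simp]: "fst (inv_dart d) = fst d"
  by (cases d) auto

lemma dart_map_inv_dart [simp]: "dart_map \<phi> (inv_dart d) = inv_dart (dart_map \<phi> d)"
  by (cases d) auto

lemma tail_inv_dart [simp]: "tail (doubled G) (inv_dart d) = head (doubled G) d"
  by (cases d) auto

lemma head_inv_dart [simp]: "head (doubled G) (inv_dart d) = tail (doubled G) d"
  by (cases d) auto

lemma inv_dart_neq [simp]: "inv_dart d \<noteq> d" "d \<noteq> inv_dart d"
  by (cases d; auto)+

lemma fst_dart_map [simp]: "fst (dart_map \<phi> d) = fst (emap \<phi> (fst d))"
  by (cases d) auto

lemma LOG_complex_simps [simp]:
  "verts (skel (LOG_complex \<Gamma>)) = {()}"
  "arcs (skel (LOG_complex \<Gamma>)) = verts (ugraph \<Gamma>)"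
  "faces (LOG_complex \<Gamma>) = arcs (ugraph \<Gamma>)"
  "bd (LOG_complex \<Gamma>) e =
     [(tail (ugraph \<Gamma>) e, True), (label \<Gamma> e, True), (head (ugraph \<Gamma>) e, False), (label \<Gamma> e, False)]"
  by (simp_all add: LOG_complex_def standard_complex_def LOG_presentation_def inv_word_def)

text \<open>
  An immersion into a LOG complex whose rotations and reflections of faces have been absorbed into
  the boundary words, so that \<open>shift\<close> and \<open>flip\<close> may be ignored.
\<close>

definition square_immersion ::
  "('v, 'e, 'f) complex2 \<Rightarrow> ('g, 'r) lgraph \<Rightarrow> ('v, 'e, 'f, unit, 'g, 'r) cell_map \<Rightarrow> bool" where
  "square_immersion X \<Gamma> \<phi> \<longleftrightarrow> wf_digraph (skel X) \<and> finite_complex2 X \<and>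
     (\<forall>a \<in> arcs (skel X). fst (emap \<phi> a) \<in> verts (ugraph \<Gamma>)) \<and>
     (\<forall>f \<in> faces X. face_map \<phi> f \<in> arcs (ugraph \<Gamma>) \<and> fst ` set (bd X f) \<subseteq> arcs (skel X) \<and>
        map (dart_map \<phi>) (bd X f) = bd (LOG_complex \<Gamma>) (face_map \<phi> f) \<and>
        (\<forall>i < 4. head (doubled (skel X)) (bd X f ! i) = tail (doubled (skel X)) (bd X f ! (Suc i mod 4)))) \<and>
     (\<forall>v \<in> verts (skel X). inj_on (dart_map \<phi>) (star (skel X) v)) \<and>
     (\<forall>f \<in> faces X. \<forall>g \<in> faces X. \<forall>i < 4. face_map \<phi> f = face_map \<phi> g \<longrightarrow>
        tail (doubled (skel X)) (bd X f ! i) = tail (doubled (skel X)) (bd X g ! i) \<longrightarrow> f = g)"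

lemma less_4_iff: "(i::nat) < 4 \<longleftrightarrow> i = 0 \<or> i = 1 \<or> i = 2 \<or> i = 3"
  by auto

lemma all_less_4: "(\<forall>i < (4 :: nat). P i) \<longleftrightarrow> P 0 \<and> P 1 \<and> P 2 \<and> P 3"
  by (metis less_4_iff)

lemma ex1_iff_card_1: "(\<exists>!x. x \<in> A) \<longleftrightarrow> card A = 1"
  by (auto simp: card_1_singleton_iff)

lemma closed_walk_4:
  assumes "length p = 4"
  shows "(\<exists>u. pre_digraph.awalk G u p u) \<longleftrightarrow> tail G (p ! 0) \<in> verts G \<and> set p \<subseteq> arcs G \<and>
    (\<forall>i < 4. head G (p ! i) = tail G (p ! (Suc i mod 4)))"
proof -
  obtain a b c d where "p = [a, b, c, d]"
    using assms by (auto simp: numeral_eq_Suc length_Suc_conv)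
  then show ?thesis
    by (simp add: pre_digraph.awalk_def pre_digraph.cas.simps all_less_4) metis
qed

text \<open>The boundary word of each face is rewritten in the order and direction of its image.
  This permutes the sides of a face, so free edges are unaffected.\<close>

lemma immersion_imp_square_immersion:
  fixes X :: "('v, 'e, 'f) complex2" and \<phi> :: "('v, 'e, 'f, unit, 'g, 'r) cell_map"
  assumes X: "is_complex2 X" "finite_complex2 X"
    and comb: "combinatorial_map X (LOG_complex \<Gamma>) \<phi>" and imm: "immersion X \<phi>"
  obtains bd' where "square_immersion (X\<lparr>bd := bd'\<rparr>) \<Gamma> \<phi>"
    "\<And>a. free_edge (X\<lparr>bd := bd'\<rparr>) a \<longleftrightarrow> free_edge X a"
proof -
  define k where "k f = shift \<phi> f mod 4" for f
  \<comment> \<open>The side of \<open>f\<close> that is mapped to side \<open>j\<close>, obtained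
    by solving the formula of \<open>side_map\<close> modulo 4.\<close>
  define idx where "idx f j = (if flip \<phi> f then (k f + 3 - j) mod 4 else (j + 4 - k f) mod 4)"
    for f and j :: nat
  \<comment> \<open>The corner mapped to corner \<open>j\<close>. A reflected side is traversed
    backwards and hence starts at the corner after its index.\<close>
  define cidx where "cidx f j = (if flip \<phi> f then Suc (idx f j) mod 4 else idx f j)" for f j
  define bd' where "bd' f = map (\<lambda>j. if flip \<phi> f then inv_dart (bd X f ! idx f j) else bd X f ! idx f j)
    [0, 1, 2, 3]" for f
  have wf: "wf_digraph (skel X)" using X by (simp add: is_complex2_def)
  have len: "length (bd X f) = 4" if "f \<in> faces X" for f
    using comb that by (auto simp: combinatorial_map_def)
  have cl: "set (bd X f) \<subseteq> arcs (doubled (skel X))"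
    "i < 4 \<Longrightarrow> head (doubled (skel X)) (bd X f ! i) = tail (doubled (skel X)) (bd X f ! (Suc i mod 4))"
    if "f \<in> faces X" for f i
    using X that closed_walk_4[OF len[OF that], of "doubled (skel X)"] by (auto simp: is_complex2_def)
  have nth': "bd' f ! j = (if flip \<phi> f then inv_dart (bd X f ! idx f j) else bd X f ! idx f j)"
    "length (bd' f) = 4" if "j < 4" for f j
    using that by (auto simp: bd'_def less_4_iff)
  have idx4: "idx f j < 4" "cidx f j < 4" for f j by (auto simp: idx_def cidx_def)
  have k4: "k f = 0 \<or> k f = 1 \<or> k f = 2 \<or> k f = 3" for f
    using less_4_iff[of "k f"] by (auto simp: k_def)
  have side_k: "snd (side_map X \<phi> (f, i)) = (if flip \<phi> f then k f + (3 - i) else k f + i) mod 4"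
    if "f \<in> faces X" for f i
    using len[OF that] by (simp add: side_map_def Let_def k_def mod_add_left_eq)
  have corner_k: "corner_map X \<phi> (f, i) =
      (face_map \<phi> f, (if flip \<phi> f then k f + (4 - i) else k f + i) mod 4)" if "f \<in> faces X" for f i
    using len[OF that] by (simp add: corner_map_def Let_def k_def mod_add_left_eq)
  have side: "snd (side_map X \<phi> (f, idx f j)) = j" if "f \<in> faces X" "j < 4" for f j
    using that k4[of f] by (auto simp: side_k idx_def less_4_iff)
  have corner: "corner_map X \<phi> (f, cidx f j) = (face_map \<phi> f, j)" if "f \<in> faces X" "j < 4" for f j
    using that k4[of f] by (auto simp: corner_k idx_def cidx_def less_4_iff)
  have idx_surj: "\<exists>j < 4. idx f j = i" if "i < 4" for f i
    using that k4[of f]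
    by (auto simp: idx_def less_4_iff ex_disj_distrib conj_disj_distribR)
  have idx_inj: "j = j'" if "f \<in> faces X" "j < 4" "j' < 4" "idx f j = idx f j'" for f j j'
    using side[of f j] side[of f j'] that by metis
  have fst': "fst (bd' f ! j) = fst (bd X f ! idx f j)" if "j < 4" for f j
    using that by (simp add: nth')
  have tail': "tail (doubled (skel X)) (bd' f ! j) = tail (doubled (skel X)) (bd X f ! cidx f j)"
    if "f \<in> faces X" "j < 4" for f j
    using cl(2)[OF that(1) idx4(1)] that by (simp add: nth' cidx_def)
  have map': "map (dart_map \<phi>) (bd' f) = bd (LOG_complex \<Gamma>) (face_map \<phi> f)" if f: "f \<in> faces X" for f
  proof (rule nth_equalityI)
    show "length (map (dart_map \<phi>) (bd' f)) = length (bd (LOG_complex \<Gamma>) (face_map \<phi> f))"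
      by (simp add: bd'_def)
    fix j assume "j < length (map (dart_map \<phi>) (bd' f))"
    then have j: "j < 4" by (simp add: bd'_def)
    have "bd (LOG_complex \<Gamma>) (face_map \<phi> f) ! snd (side_map X \<phi> (f, idx f j)) =
           (if flip \<phi> f then inv_dart (dart_map \<phi> (bd X f ! idx f j)) else dart_map \<phi> (bd X f ! idx f j))"
      using comb f idx4(1)[of f j] len[OF f] unfolding combinatorial_map_def by metis
    then show "map (dart_map \<phi>) (bd' f) ! j = bd (LOG_complex \<Gamma>) (face_map \<phi> f) ! j"
      using j f side[OF f j] by (simp add: nth' bd'_def[of f, THEN arg_cong[of _ _ length]] del: LOG_complex_simps)
  qed
  have square: "square_immersion (X\<lparr>bd := bd'\<rparr>) \<Gamma> \<phi>"
    unfolding square_immersion_def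
  proof (intro conjI ballI allI impI)
    fix f assume "f \<in> faces (X\<lparr>bd := bd'\<rparr>)"
    then have f: "f \<in> faces X" by simp
    show "face_map \<phi> f \<in> arcs (ugraph \<Gamma>)" using comb f by (simp add: combinatorial_map_def)
    show "fst ` set (bd (X\<lparr>bd := bd'\<rparr>) f) \<subseteq> arcs (skel (X\<lparr>bd := bd'\<rparr>))"
    proof
      fix a assume "a \<in> fst ` set (bd (X\<lparr>bd := bd'\<rparr>) f)"
      then obtain j where j: "j < 4" "a = fst (bd' f ! j)" by (auto simp: in_set_conv_nth nth'(2)[of 0])
      have "bd X f ! idx f j \<in> set (bd X f)" using idx4 len[OF f] by simp
      then show "a \<in> arcs (skel (X\<lparr>bd := bd'\<rparr>))" using cl(1)[OF f] j by (auto simp: fst')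
    qed
    show "map (dart_map \<phi>) (bd (X\<lparr>bd := bd'\<rparr>) f) = bd (LOG_complex \<Gamma>) (face_map \<phi> f)"
      using map'[OF f] by simp
    fix i :: nat assume i: "i < 4"
    have "head (doubled (skel X)) (bd' f ! i) = tail (doubled (skel X)) (bd' f ! (Suc i mod 4))"
    proof -
      have n: "flip \<phi> f \<Longrightarrow> Suc (idx f (Suc i mod 4)) mod 4 = idx f i"
        "\<not> flip \<phi> f \<Longrightarrow> Suc (idx f i) mod 4 = idx f (Suc i mod 4)"
        using i k4[of f] by (auto simp: idx_def less_4_iff)
      show ?thesis
        using n tail'[OF f, of "Suc i mod 4"] cl(2)[OF f idx4(1)[of f i]] i
        by (cases "flip \<phi> f") (simp_all add: nth' cidx_def)
    qed
    then show "head (doubled (skel (X\<lparr>bd := bd'\<rparr>))) (bd (X\<lparr>bd := bd'\<rparr>) f ! i) =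
        tail (doubled (skel (X\<lparr>bd := bd'\<rparr>))) (bd (X\<lparr>bd := bd'\<rparr>) f ! (Suc i mod 4))" by simp
    fix g assume "g \<in> faces (X\<lparr>bd := bd'\<rparr>)" and fg: "face_map \<phi> f = face_map \<phi> g"
      and tl: "tail (doubled (skel (X\<lparr>bd := bd'\<rparr>))) (bd (X\<lparr>bd := bd'\<rparr>) f ! i) =
        tail (doubled (skel (X\<lparr>bd := bd'\<rparr>))) (bd (X\<lparr>bd := bd'\<rparr>) g ! i)"
    then have g: "g \<in> faces X" by simp
    let ?v = "tail (doubled (skel X)) (bd X f ! cidx f i)"
    have "bd X f ! cidx f i \<in> set (bd X f)" using idx4 len[OF f] by simp
    then have "bd X f ! cidx f i \<in> arcs (doubled (skel X))" using cl(1)[OF f] by blast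
    then have "?v \<in> verts (skel X)"
      using wf_digraph.tail_in_verts[OF wf_digraph_doubled[OF wf]] by (metis doubled_simps(1))
    moreover have "(f, cidx f i) \<in> corners_at X ?v" "(g, cidx g i) \<in> corners_at X ?v"
      using f g tl tail'[OF f i] tail'[OF g i] idx4 by (auto simp: corners_at_def len)
    moreover have "corner_map X \<phi> (f, cidx f i) = corner_map X \<phi> (g, cidx g i)"
      using corner f g i fg by simp
    ultimately show "f = g" using imm by (auto simp: immersion_def dest: inj_onD)
  next
    fix v assume "v \<in> verts (skel (X\<lparr>bd := bd'\<rparr>))"
    then show "inj_on (dart_map \<phi>) (star (skel (X\<lparr>bd := bd'\<rparr>)) v)" using imm by (simp add: immersion_def)
  next
    fix a assume "a \<in> arcs (skel (X\<lparr>bd := bd'\<rparr>))"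
    then show "fst (emap \<phi> a) \<in> verts (ugraph \<Gamma>)" using comb by (auto simp: combinatorial_map_def mem_Times_iff)
  qed (use wf X in \<open>auto simp: finite_complex2_def\<close>)
  have "card (sides_at (X\<lparr>bd := bd'\<rparr>) a) = card (sides_at X a)" for a
  proof (rule bij_betw_same_card)
    show "bij_betw (\<lambda>(f, j). (f, idx f j)) (sides_at (X\<lparr>bd := bd'\<rparr>) a) (sides_at X a)"
      unfolding bij_betw_def
    proof
      show "inj_on (\<lambda>(f, j). (f, idx f j)) (sides_at (X\<lparr>bd := bd'\<rparr>) a)"
        using idx_inj by (auto simp: inj_on_def sides_at_def nth'(2)[of 0])
      show "(\<lambda>(f, j). (f, idx f j)) ` sides_at (X\<lparr>bd := bd'\<rparr>) a = sides_at X a"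
      proof (intro equalityI subsetI)
        fix x assume "x \<in> (\<lambda>(f, j). (f, idx f j)) ` sides_at (X\<lparr>bd := bd'\<rparr>) a"
        then show "x \<in> sides_at X a" by (auto simp: sides_at_def nth'(2)[of 0] fst' len idx4)
      next
        fix x assume "x \<in> sides_at X a"
        moreover obtain f i where x: "x = (f, i)" by fastforce
        ultimately have f: "f \<in> faces X" "i < 4" "fst (bd X f ! i) = a" by (auto simp: sides_at_def len)
        obtain j where "j < 4" "idx f j = i" using idx_surj[OF f(2)] by blast
        then show "x \<in> (\<lambda>(f, j). (f, idx f j)) ` sides_at (X\<lparr>bd := bd'\<rparr>) a"
          using f x by (auto simp: sides_at_def nth'(2)[of 0] fst' intro!: image_eqI[of _ _ "(f, j)"])
      qed
    qed
  qed
  then have "free_edge (X\<lparr>bd := bd'\<rparr>) a \<longleftrightarrow> free_edge X a" for a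
    unfolding free_edge_def ex1_iff_card_1 by simp
  with square that show thesis by blast
qed

text \<open>
  The corners of a square over the edge \<open>e\<close> are indexed by two Booleans: at the corner \<open>(b, b')\<close> the
  label dart lies over \<open>(label e, b)\<close> and the other one over \<open>(s(e), b')\<close> or \<open>(t(e), b')\<close>, according
  to whether \<open>b\<close> holds.
\<close>

definition ldart :: "('v, 'e, 'f) complex2 \<Rightarrow> 'f \<Rightarrow> bool \<Rightarrow> bool \<Rightarrow> 'e dart" where
  "ldart X f b b' = (let d = bd X f ! (if b' then 3 else 1) in if b = b' then inv_dart d else d)"

definition mdart :: "('v, 'e, 'f) complex2 \<Rightarrow> 'f \<Rightarrow> bool \<Rightarrow> bool \<Rightarrow> 'e dart" where
  "mdart X f b b' = (let d = bd X f ! (if b then 0 else 2) in if b = b' then d else inv_dart d)"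

definition at_corner :: "('v, 'e, 'f) complex2 \<Rightarrow> 'e dart \<Rightarrow> 'f \<Rightarrow> bool \<Rightarrow> bool \<Rightarrow> bool" where
  "at_corner X d f b b' \<longleftrightarrow> f \<in> faces X \<and> (d = ldart X f b b' \<or> d = mdart X f b b')"

section \<open>Corners, darts and faces of immersed squares\<close>

lemma in_star_iff: "d \<in> star G v \<longleftrightarrow> fst d \<in> arcs G \<and> tail (doubled G) d = v"
  by (cases d) (auto simp: star_def out_arcs_def)

text \<open>The assumption \<open>comp\<close> is compressedness; it makes the two darts at a corner
  lie over different generators.\<close>

locale immersed_squares =
  fixes X :: "('v, 'e, 'f) complex2" and \<Gamma> :: "('g, 'r) lgraph"
    and \<phi> :: "('v, 'e, 'f, unit, 'g, 'r) cell_map"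
  assumes imm: "square_immersion X \<Gamma> \<phi>"
    and comp: "e \<in> arcs (ugraph \<Gamma>) \<Longrightarrow> label \<Gamma> e \<noteq> arc_end (ugraph \<Gamma>) e b"
begin

abbreviation "src \<equiv> tail (doubled (skel X))"
abbreviation "trg \<equiv> head (doubled (skel X))"
abbreviation "\<mu> \<equiv> dart_map \<phi>"
abbreviation "\<psi> \<equiv> face_map \<phi>"

lemma wf: "wf_digraph (skel X)"
  using imm by (simp add: square_immersion_def)

lemma fin: "finite (verts (skel X))" "finite (arcs (skel X))" "finite (faces X)"
  using imm by (simp_all add: square_immersion_def finite_complex2_def)

lemma src_in_verts: "fst d \<in> arcs (skel X) \<Longrightarrow> src d \<in> verts (skel X)"
  and trg_in_verts: "fst d \<in> arcs (skel X) \<Longrightarrow> trg d \<in> verts (skel X)"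
  using wf by (cases d; auto simp: wf_digraph_def)+

lemma emap_in_verts: "a \<in> arcs (skel X) \<Longrightarrow> fst (emap \<phi> a) \<in> verts (ugraph \<Gamma>)"
  using imm by (simp add: square_immersion_def)

context
  fixes f assumes f: "f \<in> faces X"
begin

lemma face_in_arcs: "\<psi> f \<in> arcs (ugraph \<Gamma>)"
  using imm f by (simp add: square_immersion_def)

lemma bd_map: "map \<mu> (bd X f) = [(tail (ugraph \<Gamma>) (\<psi> f), True), (label \<Gamma> (\<psi> f), True),
    (head (ugraph \<Gamma>) (\<psi> f), False), (label \<Gamma> (\<psi> f), False)]"
  using imm f by (simp add: square_immersion_def)

lemma length_bd: "length (bd X f) = 4"
  using arg_cong[OF bd_map, of length] by simp

lemma bd_nth_map: "\<mu> (bd X f ! 0) = (tail (ugraph \<Gamma>) (\<psi> f), True)" "\<mu> (bd X f ! 1) = (label \<Gamma> (\<psi> f), True)"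
  "\<mu> (bd X f ! 2) = (head (ugraph \<Gamma>) (\<psi> f), False)" "\<mu> (bd X f ! 3) = (label \<Gamma> (\<psi> f), False)"
proof -
  have "\<mu> (bd X f ! i) = map \<mu> (bd X f) ! i" if "i < 4" for i using that length_bd by simp
  then show "\<mu> (bd X f ! 0) = (tail (ugraph \<Gamma>) (\<psi> f), True)" "\<mu> (bd X f ! 1) = (label \<Gamma> (\<psi> f), True)"
    "\<mu> (bd X f ! 2) = (head (ugraph \<Gamma>) (\<psi> f), False)" "\<mu> (bd X f ! 3) = (label \<Gamma> (\<psi> f), False)"
    by (simp_all add: bd_map)
qed

lemma bd_nth_closed: "trg (bd X f ! 0) = src (bd X f ! 1)" "trg (bd X f ! 1) = src (bd X f ! 2)"
  "trg (bd X f ! 2) = src (bd X f ! 3)" "trg (bd X f ! 3) = src (bd X f ! 0)"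
proof -
  have "\<forall>i < 4. trg (bd X f ! i) = src (bd X f ! (Suc i mod 4))"
    using imm f unfolding square_immersion_def by blast
  from this[rule_format, of 0] this[rule_format, of 1] this[rule_format, of 2] this[rule_format, of 3]
  show "trg (bd X f ! 0) = src (bd X f ! 1)" "trg (bd X f ! 1) = src (bd X f ! 2)"
    "trg (bd X f ! 2) = src (bd X f ! 3)" "trg (bd X f ! 3) = src (bd X f ! 0)"
    by (simp_all add: numeral_2_eq_2[symmetric])
qed

lemma bd_arcs: "fst ` set (bd X f) \<subseteq> arcs (skel X)"
  using imm f unfolding square_immersion_def by blast

lemma bd_nth_arc: "i < 4 \<Longrightarrow> fst (bd X f ! i) \<in> arcs (skel X)"
  using bd_arcs length_bd nth_mem[of i "bd X f"] by (simp add: image_subset_iff)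

lemma corner_arc: "fst (ldart X f b b') \<in> arcs (skel X)" "fst (mdart X f b b') \<in> arcs (skel X)"
  by (auto simp: ldart_def mdart_def Let_def bd_nth_arc)

lemma ldart_src: "src (ldart X f b b') = src (mdart X f b b')"
  by (cases b; cases b'; simp add: ldart_def mdart_def Let_def bd_nth_closed del: One_nat_def)

lemma ldart_map: "\<mu> (ldart X f b b') = (label \<Gamma> (\<psi> f), b)"
  by (cases b; cases b'; simp add: ldart_def Let_def bd_nth_map bd_nth_map(2)[unfolded One_nat_def])

lemma mdart_map: "\<mu> (mdart X f b b') = (arc_end (ugraph \<Gamma>) (\<psi> f) b, b')"
  by (cases b; cases b'; simp add: mdart_def Let_def bd_nth_map)

lemma ldart_neq_mdart: "ldart X f b b' \<noteq> mdart X f c c'"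
  using comp[OF face_in_arcs, of c] ldart_map[of b b'] mdart_map[of c c'] by force

end

lemma ldart_not: "ldart X f (\<not> b) b' = inv_dart (ldart X f b b')"
  by (simp add: ldart_def Let_def)

lemma mdart_not: "mdart X f b (\<not> b') = inv_dart (mdart X f b b')"
  by (simp add: mdart_def Let_def)

lemma at_corner_inv: "at_corner X d f b b' \<Longrightarrow> \<exists>b b'. at_corner X (inv_dart d) f b b'"
  unfolding at_corner_def using ldart_not mdart_not by metis

lemma dart_inj:
  "fst d \<in> arcs (skel X) \<Longrightarrow> fst d' \<in> arcs (skel X) \<Longrightarrow> src d = src d' \<Longrightarrow> \<mu> d = \<mu> d' \<Longrightarrow> d = d'"
  using imm src_in_verts[of d] by (auto simp: square_immersion_def in_star_iff dest!: bspec inj_onD)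

lemma face_inj:
  assumes f: "f \<in> faces X" and g: "g \<in> faces X" "\<psi> f = \<psi> g"
    and s: "src (ldart X f b b') = src (ldart X g b b')"
  shows "f = g"
proof -
  have inj: "src (bd X f ! i) = src (bd X g ! i) \<Longrightarrow> f = g" if "i < 4" for i
    using imm f g that unfolding square_immersion_def by blast
  show ?thesis
    using s inj[of 0] inj[of 1] inj[of 2] inj[of 3] bd_nth_closed[OF f] bd_nth_closed[OF g(1)]
    by (cases b; cases b'; simp add: ldart_def Let_def)
qed

text \<open>Each side, in each of its two directions, starts at one corner; the position
  \<open>i\<close> is kept in order to tell apart different sides at one dart.\<close>

lemma side_corner:
  assumes f: "f \<in> faces X" and i: "i < 4" and d: "fst (bd X f ! i) = fst d"
  obtains b b' where "d = ldart X f b b' \<and> i = (if b' then 3 else 1) \<or> d = mdart X f b b' \<and> i = (if b then 0 else 2)"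
proof -
  have "d = bd X f ! i \<or> d = inv_dart (bd X f ! i)"
    using d by (cases d; cases "bd X f ! i"; auto)
  moreover have "i = 0 \<or> i = 1 \<or> i = 2 \<or> i = 3" using i by auto
  ultimately have "\<exists>b b'. d = ldart X f b b' \<and> i = (if b' then 3 else 1) \<or> d = mdart X f b b' \<and> i = (if b then 0 else 2)"
    unfolding ldart_def mdart_def Let_def ex_bool_eq by auto
  then show thesis using that by blast
qed

lemma at_corner_src:
  assumes "at_corner X d f b b'"
  obtains d' where "d' \<noteq> d" "fst d' \<in> arcs (skel X)" "src d' = src d" "at_corner X d' f b b'"
  using assms ldart_src[of f b b'] ldart_neq_mdart[of f b b' b b'] corner_arc[of f b b']
  unfolding at_corner_def by metis

text \<open>An edge that is not free and occurs on one side occurs on a second one, possibly of the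
  same face, and each side contributes a corner of its own at \<open>d\<close>.\<close>

lemma two_corners:
  assumes nf: "\<not> free_edge X (fst d)" and d: "at_corner X d f b b'"
  obtains g c c' where "at_corner X d g c c'" "(g, c, c') \<noteq> (f, b, b')"
proof -
  have f: "f \<in> faces X" using d by (simp add: at_corner_def)
  have a: "fst d \<in> arcs (skel X)" using d corner_arc[OF f] by (auto simp: at_corner_def)
  define i :: nat where
    "i = (if d = ldart X f b b' then if b' then 3 else 1 else if b then 0 else 2)"
  have "i < 4" by (simp add: i_def)
  have "fst (bd X f ! i) = fst d"
    using d by (auto simp: i_def at_corner_def ldart_def mdart_def Let_def)
  then have "(f, i) \<in> sides_at X (fst d)" using f \<open>i < 4\<close> by (simp add: sides_at_def length_bd)
  then obtain g j where gj: "(g, j) \<in> sides_at X (fst d)" "(g, j) \<noteq> (f, i)"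
    using nf a unfolding free_edge_def by (metis surj_pair)
  then have g: "g \<in> faces X" "j < 4" "fst (bd X g ! j) = fst d" by (auto simp: sides_at_def length_bd)
  from side_corner[OF this] obtain c c'
    where c: "d = ldart X g c c' \<and> j = (if c' then 3 else 1) \<or> d = mdart X g c c' \<and> j = (if c then 0 else 2)" .
  have "(g, c, c') \<noteq> (f, b, b')"
  proof
    assume "(g, c, c') = (f, b, b')"
    then have eq: "g = f" "c = b" "c' = b'" by simp_all
    show False
      using c gj(2) ldart_neq_mdart[OF f, of b b' b b'] unfolding eq i_def by (auto split: if_splits)
  qed
  moreover have "at_corner X d g c c'" using c g(1) by (auto simp: at_corner_def)
  ultimately show thesis using that by blast
qed

text \<open>The converse of the normalization, needed because the hypothesis on the sub-LOT speaks
  of combinatorial immersions. Local injectivity at the sides comes from that at the corners: sides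
  of one edge with the same image run in the same direction and so start at the same vertex.\<close>

lemma combinatorial_immersion:
  assumes "\<phi>0 = \<phi>\<lparr>shift := \<lambda>_. 0, flip := \<lambda>_. False\<rparr>"
  shows "is_complex2 X" "combinatorial_map X (LOG_complex \<Gamma>) \<phi>0" "immersion X \<phi>0"
proof -
  have dm: "dart_map \<phi>0 d = \<mu> d" for d by (cases d) (simp add: assms)
  have sm: "side_map X \<phi>0 (f, i) = (\<psi> f, i)" "corner_map X \<phi>0 (f, i) = (\<psi> f, i)"
    if "f \<in> faces X" "i < 4" for f i
    using that length_bd[OF that(1)] by (simp_all add: side_map_def corner_map_def assms)
  have inj: "src (bd X f ! i) = src (bd X g ! i) \<Longrightarrow> f = g"
    if "f \<in> faces X" "g \<in> faces X" "\<psi> f = \<psi> g" "i < 4" for f g i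
    using imm that unfolding square_immersion_def by blast
  have eqm: "\<mu> (bd X f ! i) = \<mu> (bd X g ! i)"
    if "f \<in> faces X" "g \<in> faces X" "\<psi> f = \<psi> g" "i < 4" for f g i
  proof -
    have "map \<mu> (bd X f) = map \<mu> (bd X g)" using that by (simp add: bd_map)
    then show ?thesis using that length_bd by (metis nth_map)
  qed
  have "\<exists>u. pre_digraph.awalk (doubled (skel X)) u (bd X f) u" if f: "f \<in> faces X" for f
    unfolding closed_walk_4[OF length_bd[OF f]]
  proof (intro conjI)
    show "src (bd X f ! 0) \<in> verts (doubled (skel X))"
      using src_in_verts bd_nth_arc[OF f, of 0] by simp
    show "set (bd X f) \<subseteq> arcs (doubled (skel X))"
      using bd_arcs[OF f] by (auto simp: image_subset_iff mem_Times_iff)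
    show "\<forall>i<4. trg (bd X f ! i) = src (bd X f ! (Suc i mod 4))"
      using imm f unfolding square_immersion_def by blast
  qed
  moreover have "bd X f \<noteq> []" if "f \<in> faces X" for f using length_bd[OF that] by auto
  ultimately show "is_complex2 X" using wf by (simp add: is_complex2_def)
  show "combinatorial_map X (LOG_complex \<Gamma>) \<phi>0"
    unfolding combinatorial_map_def
  proof (intro conjI ballI allI impI)
    fix f i assume f: "f \<in> faces X" and i: "i < length (bd X f)"
    have "bd (LOG_complex \<Gamma>) (\<psi> f) = map \<mu> (bd X f)" by (simp add: bd_map[OF f])
    then show "bd (LOG_complex \<Gamma>) (face_map \<phi>0 f) ! snd (side_map X \<phi>0 (f, i)) =
        (if flip \<phi>0 f then inv_dart (dart_map \<phi>0 (bd X f ! i)) else dart_map \<phi>0 (bd X f ! i))"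
      using f i length_bd[OF f] sm[OF f] by (simp add: assms dm[unfolded assms] del: LOG_complex_simps)
  qed (use emap_in_verts face_in_arcs length_bd in \<open>auto simp: assms mem_Times_iff\<close>)
  show "immersion X \<phi>0"
    unfolding immersion_def
  proof (intro conjI ballI)
    fix a assume a: "a \<in> arcs (skel X)"
    show "inj_on (side_map X \<phi>0) (sides_at X a)"
    proof (rule inj_onI, clarify)
      fix f i g j assume s: "(f, i) \<in> sides_at X a" "(g, j) \<in> sides_at X a"
        and eq: "side_map X \<phi>0 (f, i) = side_map X \<phi>0 (g, j)"
      have f: "f \<in> faces X" "i < 4" "fst (bd X f ! i) = a" and g: "g \<in> faces X" "j < 4" "fst (bd X g ! j) = a"
        using s length_bd by (auto simp: sides_at_def)
      have e: "\<psi> f = \<psi> g" "i = j"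
        using eq sm[OF f(1,2)] sm[OF g(1,2)] by simp_all
      have "\<mu> (bd X f ! i) = \<mu> (bd X g ! i)" by (rule eqm) (use f g e in simp_all)
      moreover have "bd X f ! i = bd X g ! i \<or> bd X f ! i = inv_dart (bd X g ! i)"
        using f g e by (cases "bd X f ! i"; cases "bd X g ! i"; auto)
      ultimately have "bd X f ! i = bd X g ! i" by (metis dart_map_inv_dart inv_dart_neq(1))
      then show "f = g \<and> i = j" using inj f g e by metis
    qed
  next
    fix v assume v: "v \<in> verts (skel X)"
    show "inj_on (dart_map \<phi>0) (star (skel X) v)"
      using dart_inj by (auto simp: inj_on_def in_star_iff dm)
    show "inj_on (corner_map X \<phi>0) (corners_at X v)"
    proof (rule inj_onI, clarify)
      fix f i g j assume s: "(f, i) \<in> corners_at X v" "(g, j) \<in> corners_at X v"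
        and eq: "corner_map X \<phi>0 (f, i) = corner_map X \<phi>0 (g, j)"
      have f: "f \<in> faces X" "i < 4" "src (bd X f ! i) = v" and g: "g \<in> faces X" "j < 4" "src (bd X g ! j) = v"
        using s length_bd by (auto simp: corners_at_def)
      have e: "\<psi> f = \<psi> g" "i = j"
        using eq sm[OF f(1,2)] sm[OF g(1,2)] by simp_all
      then show "f = g \<and> i = j" using inj f g by metis
    qed
  qed
qed

end

section \<open>Subcomplexes of normalized immersions\<close>

definition subcomplex :: "('v, 'e, 'f) complex2 \<Rightarrow> 'v set \<Rightarrow> 'e set \<Rightarrow> 'f set \<Rightarrow> ('v, 'e, 'f) complex2" where
  "subcomplex X W A F = X\<lparr>skel := (skel X)\<lparr>verts := W, arcs := A\<rparr>, faces := F\<rparr>"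

lemma subcomplex_simps [simp]:
  "verts (skel (subcomplex X W A F)) = W" "arcs (skel (subcomplex X W A F)) = A" "faces (subcomplex X W A F) = F"
  "tail (skel (subcomplex X W A F)) = tail (skel X)" "head (skel (subcomplex X W A F)) = head (skel X)"
  "tail (doubled (skel (subcomplex X W A F))) = tail (doubled (skel X))"
  "head (doubled (skel (subcomplex X W A F))) = head (doubled (skel X))"
  "bd (subcomplex X W A F) = bd X"
  by (simp_all add: subcomplex_def fun_eq_iff)

text \<open>\<open>\<Gamma>'\<close> is \<open>\<Gamma>\<close> for the elementary collapses and the
  sub-LOT for the pieces of its preimage; in both cases the relators in question agree.\<close>

lemma subcomplex_square_immersion:
  assumes X: "square_immersion X \<Gamma> \<phi>"
    and sub: "W \<subseteq> verts (skel X)" "A \<subseteq> arcs (skel X)" "F \<subseteq> faces X"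
    and A: "\<And>a. a \<in> A \<Longrightarrow> tail (skel X) a \<in> W \<and> head (skel X) a \<in> W \<and> fst (emap \<phi> a) \<in> verts (ugraph \<Gamma>')"
    and F: "\<And>f. f \<in> F \<Longrightarrow> fst ` set (bd X f) \<subseteq> A \<and> face_map \<phi> f \<in> arcs (ugraph \<Gamma>')"
    and bd: "\<And>e. e \<in> arcs (ugraph \<Gamma>') \<Longrightarrow> bd (LOG_complex \<Gamma>') e = bd (LOG_complex \<Gamma>) e"
  shows "square_immersion (subcomplex X W A F) \<Gamma>' \<phi>"
  unfolding square_immersion_def
proof (intro conjI ballI allI impI)
  let ?C = "subcomplex X W A F"
  show "wf_digraph (skel ?C)" using A by (auto simp: wf_digraph_def)
  show "finite_complex2 ?C"
    using X finite_subset[OF sub(1)] finite_subset[OF sub(2)] finite_subset[OF sub(3)]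
    by (simp add: square_immersion_def finite_complex2_def)
  fix v assume "v \<in> verts (skel ?C)"
  then have "inj_on (dart_map \<phi>) (star (skel X) v)" using X sub by (auto simp: square_immersion_def)
  then show "inj_on (dart_map \<phi>) (star (skel ?C) v)"
    by (rule inj_on_subset) (use sub in \<open>auto simp: in_star_iff simp del: doubled_simps\<close>)
next
  fix f i assume "f \<in> faces (subcomplex X W A F)" "i < (4 :: nat)"
  then show "head (doubled (skel (subcomplex X W A F))) (bd (subcomplex X W A F) f ! i) =
      tail (doubled (skel (subcomplex X W A F))) (bd (subcomplex X W A F) f ! (Suc i mod 4))"
    using X sub unfolding square_immersion_def subcomplex_simps by blast
next
  fix f assume f: "f \<in> faces (subcomplex X W A F)"
  then show "map (dart_map \<phi>) (bd (subcomplex X W A F) f) = bd (LOG_complex \<Gamma>') (face_map \<phi> f)"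
    using X sub F bd unfolding square_immersion_def subcomplex_simps by (metis subsetD)
next
  fix f g and i :: nat assume "f \<in> faces (subcomplex X W A F)" "g \<in> faces (subcomplex X W A F)" "i < 4"
    "face_map \<phi> f = face_map \<phi> g"
    "tail (doubled (skel (subcomplex X W A F))) (bd (subcomplex X W A F) f ! i) =
     tail (doubled (skel (subcomplex X W A F))) (bd (subcomplex X W A F) g ! i)"
  then show "f = g" using X sub unfolding square_immersion_def subcomplex_simps by blast
qed (use A F in auto)

section \<open>Collapsing complexes over the sub-LOT\<close>

text \<open>A lift to the line of the map to the circle that winds each generator once around it;
  that map extends over the faces because every relator has exponent sum zero.\<close>

definition height_function :: "('v, 'e, 'f) complex2 \<Rightarrow> ('v, 'e, 'f, unit, 'g, 'r) cell_map \<Rightarrow> ('v \<Rightarrow> int) \<Rightarrow> bool" where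
  "height_function X \<phi> h \<longleftrightarrow> (\<forall>d. fst d \<in> arcs (skel X) \<longrightarrow>
     h (head (doubled (skel X)) d) = h (tail (doubled (skel X)) d) + (if snd (dart_map \<phi> d) then 1 else - 1))"

lemma snd_inv_dart [simp]: "snd (inv_dart d) = (\<not> snd d)"
  by (cases d) simp

lemma height_functionI:
  fixes X :: "('v, 'e, 'f) complex2"
  assumes "\<And>a. a \<in> arcs (skel X) \<Longrightarrow> \<exists>d. fst d = a \<and>
     h (head (doubled (skel X)) d) = h (tail (doubled (skel X)) d) + (if snd (dart_map \<phi> d) then 1 else - 1)"
  shows "height_function X \<phi> h"
  unfolding height_function_def
proof (intro allI impI)
  fix d :: "'e dart" assume "fst d \<in> arcs (skel X)"
  from assms[OF this] obtain d' where d': "fst d' = fst d"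
    "h (head (doubled (skel X)) d') = h (tail (doubled (skel X)) d') + (if snd (dart_map \<phi> d') then 1 else - 1)"
    by blast
  have "d = d' \<or> d = inv_dart d'" using d'(1) by (cases d; cases d'; auto)
  then show "h (head (doubled (skel X)) d) = h (tail (doubled (skel X)) d) + (if snd (dart_map \<phi> d) then 1 else - 1)"
    using d'(2) by (auto split: if_splits)
qed

context immersed_squares
begin

lemma subcomplex_immersed:
  assumes "W \<subseteq> verts (skel X)" "A \<subseteq> arcs (skel X)" "F \<subseteq> faces X"
    "\<And>a. a \<in> A \<Longrightarrow> tail (skel X) a \<in> W \<and> head (skel X) a \<in> W"
    "\<And>f. f \<in> F \<Longrightarrow> fst ` set (bd X f) \<subseteq> A"
  shows "square_immersion (subcomplex X W A F) \<Gamma> \<phi>"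
  by (rule subcomplex_square_immersion[OF imm])
    (use assms emap_in_verts face_in_arcs in \<open>auto simp: subset_iff\<close>)

text \<open>Elementary collapse of \<open>a\<close> together with its only face. The other three
  sides of the square still connect the ends of \<open>a\<close>, and they force the height
  difference along \<open>a\<close> because the relator has exponent sum zero.\<close>

lemma remove_free_edge:
  assumes con: "cut_connected (skel X)" and free: "free_edge X a"
  obtains C where "square_immersion C \<Gamma> \<phi>" "cut_connected (skel C)" "euler_char C = euler_char X"
    "card (arcs (skel C)) < card (arcs (skel X))"
    "\<And>h. height_function C \<phi> h \<Longrightarrow> height_function X \<phi> h"
proof -
  have a: "a \<in> arcs (skel X)" using free by (simp add: free_edge_def)
  obtain f i where fi: "sides_at X a = {(f, i)}"
    using free unfolding free_edge_def ex1_iff_card_1 by (auto simp: card_1_singleton_iff)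
  then have "(f, i) \<in> sides_at X a" by simp
  then have f: "f \<in> faces X" "i < 4" "fst (bd X f ! i) = a" by (auto simp: sides_at_def length_bd)
  have others: "fst (bd X f ! j) \<noteq> a" if "j < 4" "j \<noteq> i" for j
  proof
    assume "fst (bd X f ! j) = a"
    then have "(f, j) \<in> sides_at X a" using that f by (simp add: sides_at_def length_bd)
    then show False using fi that by auto
  qed
  define C where "C = subcomplex X (verts (skel X)) (arcs (skel X) - {a}) (faces X - {f})"
  have i4: "i = 0 \<or> i = 1 \<or> i = 2 \<or> i = 3" using f(2) by auto
  note cl = bd_nth_closed[OF f(1)]
  have sq: "square_immersion C \<Gamma> \<phi>"
    unfolding C_def
  proof (rule subcomplex_immersed)
    fix g assume g: "g \<in> faces X - {f}"
    have "a \<notin> fst ` set (bd X g)"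
    proof
      assume "a \<in> fst ` set (bd X g)"
      then obtain j where "j < 4" "fst (bd X g ! j) = a"
        using g length_bd by (auto simp: in_set_conv_nth)
      then have "(g, j) \<in> sides_at X a" using g by (simp add: sides_at_def length_bd)
      then show False using fi g by auto
    qed
    then show "fst ` set (bd X g) \<subseteq> arcs (skel X) - {a}" using bd_arcs[of g] g by auto
  qed (use wf in \<open>auto simp: wf_digraph_def\<close>)
  have conC: "cut_connected (skel C)"
    unfolding cut_connected_def
  proof (intro conjI allI impI)
    show "verts (skel C) \<noteq> {}" using con by (simp add: C_def cut_connected_def)
    fix S assume S: "S \<subset> verts (skel C)" "S \<noteq> {}"
    show "\<exists>e\<in>arcs (skel C). crosses (skel C) S e"
    proof (rule ccontr)
      assume "\<not> ?thesis"
      then have no: "e = a \<or> \<not> crosses (skel X) S e" if "e \<in> arcs (skel X)" for e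
        using that by (auto simp: C_def crosses_def)
      moreover obtain e where "e \<in> arcs (skel X)" "crosses (skel X) S e"
        using con S unfolding cut_connected_def C_def subcomplex_simps by blast
      ultimately have "crosses (skel X) S a" by blast
      then have ca: "(src d \<in> S) \<noteq> (trg d \<in> S)" if "fst d = a" for d
        using that by (cases d) (auto simp: crosses_def)
      have nc: "(src (bd X f ! j) \<in> S) = (trg (bd X f ! j) \<in> S)" if "j < 4" "j \<noteq> i" for j
        using no[OF bd_nth_arc[OF f(1) that(1)]] others[OF that]
        by (cases "bd X f ! j") (auto simp: crosses_def)
      show False
      proof -
        let ?P = "\<lambda>j. src (bd X f ! j) \<in> S"
        have n: "i \<noteq> 0 \<Longrightarrow> ?P 0 = ?P 1" "i \<noteq> 1 \<Longrightarrow> ?P 1 = ?P 2" "i \<noteq> 2 \<Longrightarrow> ?P 2 = ?P 3"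
          "i \<noteq> 3 \<Longrightarrow> ?P 3 = ?P 0"
          using nc[of 0] nc[of 1] nc[of 2] nc[of 3] unfolding cl by simp_all
        have c: "i = 0 \<Longrightarrow> ?P 0 \<noteq> ?P 1" "i = 1 \<Longrightarrow> ?P 1 \<noteq> ?P 2" "i = 2 \<Longrightarrow> ?P 2 \<noteq> ?P 3"
          "i = 3 \<Longrightarrow> ?P 3 \<noteq> ?P 0"
          using ca[OF f(3)] cl by metis+
        show False
          using i4
        proof (elim disjE)
          assume "i = 0" then show False using c(1) n(2-4) by auto
        next
          assume "i = 1" then show False using c(2) n(1,3,4) by auto
        next
          assume "i = 2" then show False using c(3) n(1,2,4) by auto
        next
          assume "i = 3" then show False using c(4) n(1,2,3) by auto
        qed
      qed
    qed
  qed
  have "height_function X \<phi> h" if h: "height_function C \<phi> h" for h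
  proof (rule height_functionI)
    fix a' assume a': "a' \<in> arcs (skel X)"
    show "\<exists>d. fst d = a' \<and> h (trg d) = h (src d) + (if snd (\<mu> d) then 1 else - 1)"
    proof (cases "a' = a")
      case False
      then show ?thesis
        using h a' by (intro exI[of _ "(a', True)"]) (simp add: height_function_def C_def del: doubled_simps dart_map.simps)
    next
      case True
      have hj: "h (trg (bd X f ! j)) = h (src (bd X f ! j)) + (if snd (\<mu> (bd X f ! j)) then 1 else - 1)"
        if "j < 4" "j \<noteq> i" for j
        using h[unfolded height_function_def C_def subcomplex_simps, rule_format, of "bd X f ! j"]
          bd_nth_arc[OF f(1) that(1)] others[OF that] by blast
      have "h (trg (bd X f ! i)) = h (src (bd X f ! i)) + (if snd (\<mu> (bd X f ! i)) then 1 else - 1)"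
        using i4 hj[of 0] hj[of 1] hj[of 2] hj[of 3] cl bd_nth_map[OF f(1)]
        by (elim disjE) (simp_all del: One_nat_def)
      then show ?thesis using f(3) True by blast
    qed
  qed
  moreover have "euler_char C = euler_char X"
  proof -
    have "card (arcs (skel X)) > 0" "card (faces X) > 0" using a f fin by (auto simp: card_gt_0_iff)
    then show ?thesis using a f fin by (simp add: euler_char_def C_def of_nat_diff)
  qed
  moreover have "card (arcs (skel C)) < card (arcs (skel X))"
    using a fin by (simp add: C_def card_gt_0_iff card_Diff1_less del: card_Diff_insert)
  ultimately show thesis using sq conC that by blast
qed

text \<open>Elementary collapse of the leaf \<open>v\<close> with its edge to \<open>u\<close>. No
  face uses that edge, since its corner at \<open>v\<close> would show a second dart there. The last
  clauses record that only \<open>u\<close> can become newly free, which is needed to find two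
  leaves.\<close>

lemma remove_free_vertex:
  assumes con: "cut_connected (skel X)" and free: "free_vertex X v"
  obtains C u where "square_immersion C \<Gamma> \<phi>" "cut_connected (skel C)" "euler_char C = euler_char X"
    "card (arcs (skel C)) < card (arcs (skel X))"
    "\<And>h. height_function C \<phi> h \<Longrightarrow> \<exists>h'. height_function X \<phi> h'"
    "u \<noteq> v" "\<And>a. free_edge C a \<Longrightarrow> free_edge X a"
    "\<And>x. free_vertex C x \<Longrightarrow> x \<noteq> v" "\<And>x. free_vertex C x \<Longrightarrow> x \<noteq> u \<Longrightarrow> free_vertex X x"
    "is_point C \<Longrightarrow> free_vertex X u"
proof -
  obtain d where st: "star (skel X) v = {d}"
    using free unfolding free_vertex_def ex1_iff_card_1 by (auto simp: card_1_singleton_iff)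
  have v: "v \<in> verts (skel X)" using free by (simp add: free_vertex_def)
  have star: "fst d' \<in> arcs (skel X) \<and> src d' = v \<longleftrightarrow> d' = d" for d'
    using st by (simp add: in_star_iff[symmetric])
  define a where "a = fst d"
  define u where "u = trg d"
  have d: "a \<in> arcs (skel X)" "src d = v" using star[of d] by (auto simp: a_def)
  have uv: "u \<noteq> v" using star[of "inv_dart d"] d by (auto simp: u_def a_def)
  have u: "u \<in> verts (skel X)" using trg_in_verts d by (simp add: u_def a_def)
  have ends: "{tail (skel X) a, head (skel X) a} = {u, v}"
    using d(2) by (cases d) (auto simp: u_def a_def split: if_splits)
  define C where "C = subcomplex X (verts (skel X) - {v}) (arcs (skel X) - {a}) (faces X)"
  have nv: "tail (skel X) e \<noteq> v" "head (skel X) e \<noteq> v" if "e \<in> arcs (skel X)" "e \<noteq> a" for e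
    using star[of "(e, True)"] star[of "(e, False)"] that by (auto simp: a_def)
  have sq: "square_immersion C \<Gamma> \<phi>"
    unfolding C_def
  proof (rule subcomplex_immersed)
    fix g assume g: "g \<in> faces X"
    have "a \<notin> fst ` set (bd X g)"
    proof
      assume "a \<in> fst ` set (bd X g)"
      then obtain j where "j < 4" "fst (bd X g ! j) = fst d"
        using g length_bd by (auto simp: in_set_conv_nth a_def)
      from side_corner[OF g this] obtain b b' where "at_corner X d g b b'"
        using g unfolding at_corner_def by metis
      from at_corner_src[OF this] obtain d' where "d' \<noteq> d" "fst d' \<in> arcs (skel X)" "src d' = src d" .
      then show False using star[of d'] d by simp
    qed
    then show "fst ` set (bd X g) \<subseteq> arcs (skel X) - {a}" using bd_arcs[of g] g by auto
  next
    fix e assume "e \<in> arcs (skel X) - {a}"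
    then show "tail (skel X) e \<in> verts (skel X) - {v} \<and> head (skel X) e \<in> verts (skel X) - {v}"
      using nv[of e] wf by (auto simp: wf_digraph_def)
  qed auto
  have conC: "cut_connected (skel C)"
    unfolding cut_connected_def
  proof (intro conjI allI impI)
    show "verts (skel C) \<noteq> {}" using u uv by (auto simp: C_def)
    fix S assume S: "S \<subset> verts (skel C)" "S \<noteq> {}"
    define T where "T = (if u \<in> S then insert v S else S)"
    have "T \<subset> verts (skel X)" "T \<noteq> {}" using S v by (auto simp: T_def C_def)
    then obtain e where e: "e \<in> arcs (skel X)" "crosses (skel X) T e"
      using con by (auto simp: cut_connected_def)
    have "v \<notin> S" using S by (auto simp: C_def)
    have "(tail (skel X) a \<in> T) = (head (skel X) a \<in> T)"
      using ends \<open>v \<notin> S\<close> uv by (auto simp: T_def doubleton_eq_iff)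
    then have "e \<noteq> a" using e by (auto simp: crosses_def)
    then have "crosses (skel C) S e" using e nv[of e] by (auto simp: crosses_def C_def T_def split: if_splits)
    then show "\<exists>e\<in>arcs (skel C). crosses (skel C) S e" using e \<open>e \<noteq> a\<close> by (auto simp: C_def)
  qed
  have "\<exists>h'. height_function X \<phi> h'" if h: "height_function C \<phi> h" for h
  proof
    define h' where "h' = h(v := h u - (if snd (\<mu> d) then 1 else - 1))"
    show "height_function X \<phi> h'"
    proof (rule height_functionI)
      fix e assume e: "e \<in> arcs (skel X)"
      show "\<exists>d. fst d = e \<and> h' (trg d) = h' (src d) + (if snd (\<mu> d) then 1 else - 1)"
      proof (cases "e = a")
        case True
        then show ?thesis using d uv by (intro exI[of _ d]) (auto simp: a_def h'_def u_def)
      next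
        case False
        have "h (trg (e, True)) = h (src (e, True)) + (if snd (\<mu> (e, True)) then 1 else - 1)"
          using h e False by (simp add: height_function_def C_def del: doubled_simps dart_map.simps)
        then show ?thesis
          using nv[OF e False] by (intro exI[of _ "(e, True)"]) (simp add: h'_def)
      qed
    qed
  qed
  moreover have "euler_char C = euler_char X"
  proof -
    have "card (arcs (skel X)) > 0" "card (verts (skel X)) > 0" using d v fin by (auto simp: card_gt_0_iff)
    then show ?thesis using d v fin by (simp add: euler_char_def C_def of_nat_diff)
  qed
  moreover have "card (arcs (skel C)) < card (arcs (skel X))"
    using d fin by (simp add: C_def card_gt_0_iff card_Diff1_less del: card_Diff_insert)
  moreover have "free_edge X e" if "free_edge C e" for e
    using that by (auto simp: free_edge_def sides_at_def C_def)
  moreover have "x \<noteq> v" if "free_vertex C x" for x using that by (auto simp: free_vertex_def C_def)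
  moreover have "free_vertex X x" if x: "free_vertex C x" "x \<noteq> u" for x
  proof -
    have "x \<noteq> v" "x \<in> verts (skel X)" using x by (auto simp: free_vertex_def C_def)
    moreover have "star (skel X) x = star (skel C) x"
    proof -
      have "src e \<noteq> x" if "fst e = a" for e
        using ends that \<open>x \<noteq> v\<close> \<open>x \<noteq> u\<close> by (cases e) (auto simp: doubleton_eq_iff)
      then have "e \<in> star (skel X) x \<longleftrightarrow> e \<in> star (skel C) x" for e
        unfolding in_star_iff C_def subcomplex_simps by blast
      then show ?thesis by blast
    qed
    ultimately show ?thesis using x by (simp add: free_vertex_def)
  qed
  moreover have "free_vertex X u" if "is_point C"
  proof -
    have A: "arcs (skel X) = {a}" using that d by (auto simp: is_point_def C_def)
    have "star (skel X) u = {inv_dart d}"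
    proof (intro equalityI subsetI)
      fix e assume "e \<in> star (skel X) u"
      then have e: "fst e = a" "src e = u" using A by (auto simp: in_star_iff)
      then have "e = d \<or> e = inv_dart d" by (cases e; cases d; auto simp: a_def)
      then show "e \<in> {inv_dart d}" using e d uv by auto
    qed (use d in \<open>auto simp: in_star_iff u_def a_def\<close>)
    then show ?thesis using u by (auto simp: free_vertex_def)
  qed
  ultimately show thesis using sq conC uv that by blast
qed

end

text \<open>Induction over collapses, which preserve the Euler characteristic and carry heights
  back. They end at a complex without free cells, to which the hypothesis applies. The last clause
  reflects that a finite tree with an edge has two leaves.\<close>

lemma collapsing_dichotomy:
  fixes C :: "(nat, nat, nat) complex2" and \<Gamma> :: "('g, 'r) lgraph"
  assumes cnpi: "collapsing_nonpositive_immersion (LOG_complex \<Gamma>)"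
    and comp: "\<And>e b. e \<in> arcs (ugraph \<Gamma>) \<Longrightarrow> label \<Gamma> e \<noteq> arc_end (ugraph \<Gamma>) e b"
    and "square_immersion C \<Gamma> \<phi>" "cut_connected (skel C)"
  shows "euler_char C \<le> 0 \<or> euler_char C = 1 \<and> (\<exists>h. height_function C \<phi> h) \<and>
    ((\<exists>a. free_edge C a) \<or> is_point C \<or> (\<exists>u v. u \<noteq> v \<and> free_vertex C u \<and> free_vertex C v))"
  using assms(3,4)
proof (induction "card (arcs (skel C))" arbitrary: C rule: less_induct)
  case less
  interpret immersed_squares C \<Gamma> \<phi> by unfold_locales (use less.prems comp in auto)
  consider a where "free_edge C a" | v where "\<nexists>a. free_edge C a" "free_vertex C v"
    | "\<nexists>a. free_edge C a" "\<nexists>v. free_vertex C v" by blast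
  then show ?case
  proof cases
    case 1
    from remove_free_edge[OF less.prems(2) 1] obtain C' where "square_immersion C' \<Gamma> \<phi>" "cut_connected (skel C')"
      "euler_char C' = euler_char C" "card (arcs (skel C')) < card (arcs (skel C))"
      "\<And>h. height_function C' \<phi> h \<Longrightarrow> height_function C \<phi> h" by blast
    then show ?thesis using less.hyps[of C'] 1 by metis
  next
    case 2
    obtain C' u where C': "square_immersion C' \<Gamma> \<phi>" "cut_connected (skel C')"
      "euler_char C' = euler_char C" "card (arcs (skel C')) < card (arcs (skel C))"
      "\<And>h. height_function C' \<phi> h \<Longrightarrow> \<exists>h'. height_function C \<phi> h'"
      "u \<noteq> v" "\<And>a. free_edge C' a \<Longrightarrow> free_edge C a"
      "\<And>x. free_vertex C' x \<Longrightarrow> x \<noteq> v" "\<And>x. free_vertex C' x \<Longrightarrow> x \<noteq> u \<Longrightarrow> free_vertex C x"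
      "is_point C' \<Longrightarrow> free_vertex C u"
      by (rule remove_free_vertex[OF less.prems(2) 2(2)]) blast
    from less.hyps[OF C'(4,1,2)] show ?thesis
    proof
      assume "euler_char C' \<le> 0"
      then show ?thesis using C'(3) by simp
    next
      assume *: "euler_char C' = 1 \<and> (\<exists>h. height_function C' \<phi> h) \<and>
        ((\<exists>a. free_edge C' a) \<or> is_point C' \<or> (\<exists>u v. u \<noteq> v \<and> free_vertex C' u \<and> free_vertex C' v))"
      \<comment> \<open>\<open>C'\<close> has no free edge. If it is a point, then \<open>u\<close>
        is free in \<open>C\<close>; otherwise one of its two free vertices differs from
        \<open>u\<close> and is free in \<open>C\<close> as well.\<close>
      have "\<exists>w. w \<noteq> v \<and> free_vertex C w"
        using * C'(6-10) 2(1) by metis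
      then show ?thesis using * C'(3,5) 2(2) by metis
    qed
  next
    case 3
    define \<phi>0 where "\<phi>0 = \<phi>\<lparr>shift := \<lambda>_. 0, flip := \<lambda>_. False\<rparr>"
    have "connected (skel C)" using less.prems(2) connected_iff_cut_connected[OF wf] by simp
    moreover have "finite_complex2 C" using fin by (simp add: finite_complex2_def)
    ultimately have "euler_char C \<le> 0 \<or> is_point C"
      using cnpi combinatorial_immersion[OF \<phi>0_def] 3 unfolding collapsing_nonpositive_immersion_def by blast
    moreover have "euler_char C = 1" "height_function C \<phi> (\<lambda>_. 0)" if "is_point C"
      using that by (auto simp: is_point_def euler_char_def height_function_def)
    ultimately show ?thesis by blast
  qed
qed

section \<open>Outer darts and orphans\<close>

lemma card_ge_2I: "finite A \<Longrightarrow> x \<in> A \<Longrightarrow> y \<in> A \<Longrightarrow> x \<noteq> y \<Longrightarrow> 2 \<le> card A"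
  using card_mono[of A "{x, y}"] by simp

lemma finite_has_maximum:
  fixes f :: "'a \<Rightarrow> 'b :: linorder"
  assumes "finite A" "A \<noteq> {}"
  shows "\<exists>x \<in> A. \<forall>y \<in> A. f y \<le> f x"
proof -
  have "Max (f ` A) \<in> f ` A" using assms by simp
  then obtain x where "x \<in> A" "f x = Max (f ` A)" by auto
  moreover have "\<forall>y \<in> A. f y \<le> Max (f ` A)" using assms(1) by simp
  ultimately show ?thesis by metis
qed

text \<open>
  \<open>V1\<close> and \<open>E1\<close> are the vertices and edges of the sub-LOT. The dart \<open>(x, b)\<close> of the LOG complex is of
  class \<open>c\<close> if \<open>(b = \<epsilon> x) = c\<close>; the corner of class \<open>c\<close> over \<open>e\<close> joins \<open>ch c e\<close> to its parent \<open>pa c e\<close>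
  in the tree of class \<open>c\<close>, whose root is the whole of \<open>V1\<close>.
\<close>

locale angled_squares = immersed_squares X \<Gamma> \<phi>
  for X :: "('v, 'e, 'f) complex2" and \<Gamma> :: "('g, 'r) lgraph"
    and \<phi> :: "('v, 'e, 'f, unit, 'g, 'r) cell_map" +
  fixes V1 :: "'g set" and E1 :: "'r set" and \<epsilon> :: "'g \<Rightarrow> bool"
    and ch pa :: "bool \<Rightarrow> 'r \<Rightarrow> 'g" and rk :: "bool \<Rightarrow> 'g \<Rightarrow> nat"
  assumes no_free_edge: "\<not> free_edge X a"
    and no_free_vertex: "\<not> free_vertex X v"
    and X_connected: "cut_connected (skel X)"
    and E1_V1: "e \<in> E1 \<Longrightarrow> label \<Gamma> e \<in> V1 \<and> arc_end (ugraph \<Gamma>) e b \<in> V1"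
    and \<epsilon>_V1: "z \<in> V1 \<Longrightarrow> z' \<in> V1 \<Longrightarrow> \<epsilon> z = \<epsilon> z'"
    and not_both_V1: "e \<in> arcs (ugraph \<Gamma>) - E1 \<Longrightarrow> label \<Gamma> e \<in> V1 \<Longrightarrow> arc_end (ugraph \<Gamma>) e b \<notin> V1"
    and ch_inj: "inj_on (ch c) (arcs (ugraph \<Gamma>) - E1)"
    and ch_V1: "e \<in> arcs (ugraph \<Gamma>) - E1 \<Longrightarrow> ch c e \<notin> V1"
    and ch_pa: "e \<in> arcs (ugraph \<Gamma>) - E1 \<Longrightarrow>
      (ch c e, pa c e) \<in> {(label \<Gamma> e, arc_end (ugraph \<Gamma>) e (\<epsilon> (label \<Gamma> e) = c)),
                         (arc_end (ugraph \<Gamma>) e (\<epsilon> (label \<Gamma> e) = c), label \<Gamma> e)}"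
    and rk: "e \<in> arcs (ugraph \<Gamma>) - E1 \<Longrightarrow> pa c e \<notin> V1 \<Longrightarrow> rk c (pa c e) < rk c (ch c e)"
begin

definition gen :: "'e dart \<Rightarrow> 'g" where "gen d = fst (\<mu> d)"

definition cls :: "'e dart \<Rightarrow> bool" where "cls d \<longleftrightarrow> snd (\<mu> d) = \<epsilon> (gen d)"

definition outer :: "'e dart \<Rightarrow> bool" where "outer d \<longleftrightarrow> fst d \<in> arcs (skel X) \<and> gen d \<notin> V1"

definition outer_faces :: "'f set" where "outer_faces = {f \<in> faces X. \<psi> f \<notin> E1}"

text \<open>\<open>lside e c\<close> and \<open>mside e c\<close> solve for the two indices of the
  corner over \<open>e\<close> at which both darts have class \<open>c\<close>. The second depends
  on the first, which selects the source or the target of \<open>e\<close>.\<close>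

definition lside :: "'r \<Rightarrow> bool \<Rightarrow> bool" where
  "lside e c \<longleftrightarrow> \<epsilon> (label \<Gamma> e) = c"

definition mside :: "'r \<Rightarrow> bool \<Rightarrow> bool" where
  "mside e c \<longleftrightarrow> \<epsilon> (arc_end (ugraph \<Gamma>) e (lside e c)) = c"

definition cdart :: "'f \<Rightarrow> bool \<Rightarrow> 'e dart" where
  "cdart f c = (if ch c (\<psi> f) = label \<Gamma> (\<psi> f) then ldart X f (lside (\<psi> f) c) (mside (\<psi> f) c)
    else mdart X f (lside (\<psi> f) c) (mside (\<psi> f) c))"

definition pdart :: "'f \<Rightarrow> bool \<Rightarrow> 'e dart" where
  "pdart f c = (if ch c (\<psi> f) = label \<Gamma> (\<psi> f) then mdart X f (lside (\<psi> f) c) (mside (\<psi> f) c)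
    else ldart X f (lside (\<psi> f) c) (mside (\<psi> f) c))"

definition orphan :: "'e dart \<Rightarrow> bool" where
  "orphan d \<longleftrightarrow> outer d \<and> \<not> (\<exists>f \<in> outer_faces. \<exists>c. d = cdart f c)"

text \<open>Only these darts of the preimage of the sub-LOT can be parents of outer darts; here a
  climb through a tree reaches its collapsed root.\<close>

definition touching :: "'e dart \<Rightarrow> bool" where
  "touching d \<longleftrightarrow> gen d \<in> V1 \<and> (\<exists>f \<in> outer_faces. \<exists>b b'. at_corner X d f b b')"

lemma outer_faces_in: "f \<in> outer_faces \<Longrightarrow> f \<in> faces X" "f \<in> outer_faces \<Longrightarrow> \<psi> f \<in> arcs (ugraph \<Gamma>) - E1"
  using face_in_arcs by (auto simp: outer_faces_def)

lemma at_corner_arc: "at_corner X d f b b' \<Longrightarrow> fst d \<in> arcs (skel X)"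
  using corner_arc unfolding at_corner_def by metis

lemma cdart_pdart:
  assumes "f \<in> outer_faces"
  shows "gen (cdart f c) = ch c (\<psi> f)" "cls (cdart f c) = c" "gen (pdart f c) = pa c (\<psi> f)" "cls (pdart f c) = c"
    "at_corner X (cdart f c) f (lside (\<psi> f) c) (mside (\<psi> f) c)"
    "at_corner X (pdart f c) f (lside (\<psi> f) c) (mside (\<psi> f) c)"
    "src (cdart f c) = src (ldart X f (lside (\<psi> f) c) (mside (\<psi> f) c))"
    "src (pdart f c) = src (cdart f c)" "outer (cdart f c)"
proof -
  note f = outer_faces_in[OF assms]
  let ?e = "\<psi> f"
  have cp: "(ch c ?e, pa c ?e) \<in> {(label \<Gamma> ?e, arc_end (ugraph \<Gamma>) ?e (lside ?e c)),
      (arc_end (ugraph \<Gamma>) ?e (lside ?e c), label \<Gamma> ?e)}"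
    using ch_pa[OF f(2), of c] by (simp add: lside_def)
  have ne: "label \<Gamma> ?e \<noteq> arc_end (ugraph \<Gamma>) ?e (lside ?e c)" using comp f(2) by blast
  note lm = ldart_map[OF f(1)] mdart_map[OF f(1)]
  have c: "\<mu> (cdart f c) = (ch c ?e, \<epsilon> (ch c ?e) = c)"
  proof (cases "ch c ?e = label \<Gamma> ?e")
    case True
    then show ?thesis by (simp add: cdart_def lm lside_def)
  next
    case False
    then have "ch c ?e = arc_end (ugraph \<Gamma>) ?e (lside ?e c)" using cp by blast
    then show ?thesis using False by (simp add: cdart_def lm mside_def del: doubled_simps)
  qed
  have p: "\<mu> (pdart f c) = (pa c ?e, \<epsilon> (pa c ?e) = c)"
  proof (cases "ch c ?e = label \<Gamma> ?e")
    case True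
    then have "pa c ?e = arc_end (ugraph \<Gamma>) ?e (lside ?e c)"
      using cp ne by (simp del: doubled_simps)
    then show ?thesis using True by (simp add: pdart_def lm mside_def del: doubled_simps)
  next
    case False
    then have "pa c ?e = label \<Gamma> ?e" using cp by blast
    then show ?thesis using False by (simp add: pdart_def lm lside_def)
  qed
  show g: "gen (cdart f c) = ch c ?e" "cls (cdart f c) = c" "gen (pdart f c) = pa c ?e" "cls (pdart f c) = c"
    using c p by (auto simp: gen_def cls_def)
  show a: "at_corner X (cdart f c) f (lside ?e c) (mside ?e c)" "at_corner X (pdart f c) f (lside ?e c) (mside ?e c)"
    using f(1) by (auto simp: at_corner_def cdart_def pdart_def)
  show "src (cdart f c) = src (ldart X f (lside ?e c) (mside ?e c))" "src (pdart f c) = src (cdart f c)"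
    using ldart_src[OF f(1)] by (simp_all add: cdart_def pdart_def del: doubled_simps)
  show "outer (cdart f c)" using at_corner_arc[OF a(1)] g(1) ch_V1[OF f(2)] by (simp add: outer_def)
qed

text \<open>The class of the label dart determines \<open>b\<close>, whereupon that of the other
  dart determines \<open>b'\<close>. A corner between darts of equal class therefore has angle
  0.\<close>

lemma pure_corner:
  assumes f: "f \<in> outer_faces" and d: "at_corner X d f b b'"
    and c: "cls (ldart X f b b') = c" "cls (mdart X f b b') = c"
  shows "b = lside (\<psi> f) c" "b' = mside (\<psi> f) c" "d = cdart f c \<or> d = pdart f c"
proof -
  note f' = outer_faces_in[OF f]
  show b: "b = lside (\<psi> f) c" using c(1) ldart_map[OF f'(1)] by (auto simp: cls_def gen_def lside_def)
  show "b' = mside (\<psi> f) c"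
    using c(2) mdart_map[OF f'(1)] unfolding b by (auto simp: cls_def gen_def mside_def simp del: doubled_simps)
  with b d show "d = cdart f c \<or> d = pdart f c" by (auto simp: at_corner_def cdart_def pdart_def)
qed

text \<open>The child dart determines the class, then the relator because \<open>ch c\<close> is
  injective, and finally the face by local injectivity.\<close>

lemma cdart_inj:
  assumes f: "f \<in> outer_faces" and g: "g \<in> outer_faces" and eq: "cdart f c = cdart g c'"
  shows "f = g \<and> c = c'"
proof -
  have c: "c = c'" using cdart_pdart(2)[OF f, of c] cdart_pdart(2)[OF g, of c'] eq by simp
  then have "ch c (\<psi> f) = ch c (\<psi> g)" using cdart_pdart(1)[OF f, of c] cdart_pdart(1)[OF g, of c'] eq by simp
  then have e: "\<psi> f = \<psi> g" using ch_inj outer_faces_in f g by (metis inj_onD)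
  have "src (ldart X f (lside (\<psi> f) c) (mside (\<psi> f) c)) = src (ldart X g (lside (\<psi> f) c) (mside (\<psi> f) c))"
    using cdart_pdart(7)[OF f, of c] cdart_pdart(7)[OF g, of c'] eq c e by simp
  from face_inj[OF outer_faces_in(1)[OF f] outer_faces_in(1)[OF g] e this] c show ?thesis by simp
qed

section \<open>Finding orphans at a vertex\<close>

lemma outer_face:
  assumes "outer d" "at_corner X d f b b'"
  shows "f \<in> outer_faces"
proof -
  have f: "f \<in> faces X" using assms(2) by (simp add: at_corner_def)
  have "\<psi> f \<notin> E1"
    using assms E1_V1[of "\<psi> f" b] ldart_map[OF f, of b b'] mdart_map[OF f, of b b']
    by (auto simp: outer_def gen_def at_corner_def simp del: doubled_simps fst_dart_map)
  with f show ?thesis by (simp add: outer_faces_def)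
qed

lemma outer_or_touching:
  assumes "at_corner X d f b b'" "f \<in> outer_faces"
  shows "outer d \<or> touching d"
  using assms at_corner_arc[OF assms(1)] by (auto simp: outer_def touching_def)

text \<open>Climb from child to parent at the fixed vertex \<open>src d\<close>: the rank decreases
  until an orphan or a dart over the sub-LOT is met. The comparison of ranks serves
  \<open>isolated_vertex_orphans\<close>.\<close>

lemma ancestor:
  assumes "outer d"
  shows "\<exists>d'. src d' = src d \<and> cls d' = cls d \<and>
    (orphan d' \<and> (d' = d \<or> rk (cls d) (gen d') < rk (cls d) (gen d)) \<or> touching d')"
  using assms
proof (induction "rk (cls d) (gen d)" arbitrary: d rule: less_induct)
  case less
  show ?case
  proof (cases "orphan d")
    case True
    then show ?thesis by blast
  next
    case False
    then obtain f c where f: "f \<in> outer_faces" "d = cdart f c" using less.prems by (auto simp: orphan_def)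
    note cp = cdart_pdart[OF f(1), of c]
    have c: "cls d = c" using cp f by simp
    show ?thesis
    proof (cases "touching (pdart f c)")
      case True
      then show ?thesis using cp f c by metis
    next
      case False
      then have o: "outer (pdart f c)" using outer_or_touching cp(6) f(1) by blast
      have r: "rk c (gen (pdart f c)) < rk c (gen d)"
        using rk[OF outer_faces_in(2)[OF f(1)], of c] o cp f by (simp add: outer_def)
      have s: "cls (pdart f c) = cls d" "src (pdart f c) = src d" using cp f c by simp_all
      from less.hyps[OF _ o] r s c obtain d' where d': "src d' = src d" "cls d' = cls d"
        "orphan d' \<and> (d' = pdart f c \<or> rk (cls d) (gen d') < rk (cls d) (gen (pdart f c))) \<or> touching d'"
        unfolding s c by blast
      moreover have "rk (cls d) (gen d') < rk (cls d) (gen d)"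
        if "d' = pdart f c \<or> rk (cls d) (gen d') < rk (cls d) (gen (pdart f c))"
        using that r unfolding c by (elim disjE) simp_all
      ultimately show ?thesis by blast
    qed
  qed
qed

text \<open>
  A dart of maximal rank has no children, so a second corner at it must have angle \<open>\<pi>\<close>.
\<close>

lemma top_dart:
  assumes d: "outer d"
    and max: "\<And>d'. outer d' \<Longrightarrow> src d' = src d \<Longrightarrow> cls d' = cls d \<Longrightarrow> rk (cls d) (gen d') \<le> rk (cls d) (gen d)"
  shows "orphan d \<or> (\<exists>d'. src d' = src d \<and> cls d' \<noteq> cls d \<and> (outer d' \<or> touching d'))"
proof (rule ccontr)
  assume neg: "\<not> ?thesis"
  then obtain f c where f: "f \<in> outer_faces" "d = cdart f c" using d by (auto simp: orphan_def)
  have c: "cls d = c" using cdart_pdart(2)[OF f(1)] f by simp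
  \<comment> \<open>If the claim fails, all darts joined to \<open>d\<close> by a corner have its
    class, so every corner at \<open>d\<close> has angle 0.\<close>
  have pure: "b = lside (\<psi> g) c \<and> b' = mside (\<psi> g) c \<and> (d = cdart g c \<or> d = pdart g c) \<and> g \<in> outer_faces"
    if a: "at_corner X d g b b'" for g b b'
  proof -
    have g: "g \<in> outer_faces" by (rule outer_face[OF d a])
    note gf = outer_faces_in(1)[OF g]
    have "cls d' = c" if "at_corner X d' g b b'" for d'
    proof -
      have "src d' = src d" using a that ldart_src[OF gf] unfolding at_corner_def by metis
      then show ?thesis using neg outer_or_touching[OF that g] c by blast
    qed
    then have "cls (ldart X g b b') = c" "cls (mdart X g b b') = c" using gf by (auto simp: at_corner_def)
    from pure_corner[OF g a this] g show ?thesis by simp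
  qed
  have f1: "at_corner X d f (lside (\<psi> f) c) (mside (\<psi> f) c)" using cdart_pdart(5)[OF f(1)] f by simp
  obtain g b b' where g: "at_corner X d g b b'" "(g, b, b') \<noteq> (f, lside (\<psi> f) c, mside (\<psi> f) c)"
    by (rule two_corners[OF no_free_edge f1])
  from pure[OF g(1)] consider "g \<in> outer_faces" "d = cdart g c" | "g \<in> outer_faces" "d = pdart g c" by blast
  then show False
  proof cases
    case 1
    then have "f = g" using cdart_inj f by metis
    then show False using pure[OF g(1)] g(2) by simp
  next
    case 2
    note cp = cdart_pdart[OF 2(1), of c]
    have "rk c (gen (cdart g c)) \<le> rk c (gen d)" using max[of "cdart g c"] cp 2 c by simp
    moreover have "rk c (gen d) < rk c (gen (cdart g c))"
      using rk[OF outer_faces_in(2)[OF 2(1)], of c] cp 2 d by (simp add: outer_def)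
    ultimately show False by simp
  qed
qed

lemma finite_outer: "finite {d. outer d}"
  by (rule finite_subset[of _ "arcs (skel X) \<times> UNIV"]) (use fin in \<open>auto simp: outer_def\<close>)

lemma max_dart:
  assumes "outer d"
  obtains d' where "outer d'" "src d' = src d" "cls d' = cls d"
    "\<And>d''. outer d'' \<Longrightarrow> src d'' = src d' \<Longrightarrow> cls d'' = cls d' \<Longrightarrow> rk (cls d') (gen d'') \<le> rk (cls d') (gen d')"
proof -
  let ?A = "{d'. outer d' \<and> src d' = src d \<and> cls d' = cls d}"
  have "finite ?A" by (rule finite_subset[OF _ finite_outer]) blast
  moreover have "?A \<noteq> {}" using assms by blast
  ultimately obtain d' where "d' \<in> ?A" "\<forall>d'' \<in> ?A. rk (cls d) (gen d'') \<le> rk (cls d) (gen d')"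
    using finite_has_maximum[of ?A "\<lambda>d'. rk (cls d) (gen d')"] by blast
  then show thesis using that[of d'] by auto
qed

text \<open>Without orphans at the vertex, every outer dart has a touching ancestor of its class.
  Applied to an outer dart of maximal rank, \<open>top_dart\<close> supplies the other
  class.\<close>

lemma touching_both:
  assumes d: "outer d \<or> touching d" and no: "\<And>d'. src d' = src d \<Longrightarrow> \<not> orphan d'"
  shows "\<exists>d'. touching d' \<and> src d' = src d \<and> cls d' = c"
proof -
  have anc: "\<exists>d''. touching d'' \<and> src d'' = src d \<and> cls d'' = cls d'" if "outer d'" "src d' = src d" for d'
    using ancestor[OF that(1)] no that(2) by metis
  have "\<exists>d'. outer d' \<and> src d' = src d"
  proof (cases "outer d")
    case False
    then obtain f b b' where f: "f \<in> outer_faces" "at_corner X d f b b'" using d by (auto simp: touching_def)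
    then have gV: "gen d \<in> V1" using d False by (auto simp: touching_def)
    note f' = outer_faces_in[OF f(1)]
    from at_corner_src[OF f(2)] obtain d' where d': "d' \<noteq> d" "fst d' \<in> arcs (skel X)" "src d' = src d" "at_corner X d' f b b'" .
    \<comment> \<open>By \<open>not_both_V1\<close> only one of the two darts at a corner of an
      outer face can lie over \<open>V1\<close>, so the partner of a touching dart is outer.\<close>
    have "gen d' \<notin> V1"
      using d'(1,4) f(2) gV not_both_V1[OF f'(2), of b] ldart_map[OF f'(1), of b b'] mdart_map[OF f'(1), of b b']
      by (auto simp: at_corner_def gen_def simp del: doubled_simps fst_dart_map)
    then have "outer d'" using d'(2) by (simp add: outer_def)
    then show ?thesis using d'(3) by blast
  qed blast
  then obtain d0 where d0: "outer d0" "src d0 = src d" by blast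
  from max_dart[OF d0(1)] obtain d1 where d1: "outer d1" "src d1 = src d0" "cls d1 = cls d0"
    "\<And>d''. outer d'' \<Longrightarrow> src d'' = src d1 \<Longrightarrow> cls d'' = cls d1 \<Longrightarrow> rk (cls d1) (gen d'') \<le> rk (cls d1) (gen d1)" by metis
  have s1: "src d1 = src d" using d1(2) d0(2) by simp
  from top_dart[OF d1(1) d1(4)] no[OF s1] obtain d2 where d2: "src d2 = src d" "cls d2 \<noteq> cls d1" "outer d2 \<or> touching d2"
    unfolding s1 by blast
  have "\<exists>d''. touching d'' \<and> src d'' = src d \<and> cls d'' = cls d2" using d2 anc by blast
  moreover have "\<exists>d''. touching d'' \<and> src d'' = src d \<and> cls d'' = cls d1" using anc[OF d1(1) s1] .
  moreover have "c = cls d1 \<or> c = cls d2" using d2(2) by blast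
  ultimately show ?thesis by blast
qed

text \<open>Here no dart is touching, so every dart has an orphan ancestor of its own class. If
  \<open>p\<close> were the only orphan, all darts would share its class and a dart of maximal rank
  would be an orphan, hence \<open>p\<close>. Every other dart has rank above \<open>p\<close>, so
  \<open>p\<close> would be the only dart at \<open>v\<close>, making \<open>v\<close> free.\<close>

lemma isolated_vertex_orphans:
  assumes v: "v \<in> verts (skel X)" and ne: "star (skel X) v \<noteq> {}"
    and out: "\<And>d. d \<in> star (skel X) v \<Longrightarrow> outer d"
  shows "\<exists>d d'. d \<noteq> d' \<and> orphan d \<and> orphan d' \<and> src d = v \<and> src d' = v"
proof -
  have st: "d \<in> star (skel X) v" if "outer d" "src d = v" for d using that by (simp add: in_star_iff outer_def)
  have nt: "\<not> touching d" if "src d = v" for d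
  proof
    assume t: "touching d"
    then have "fst d \<in> arcs (skel X)" using at_corner_arc unfolding touching_def by blast
    then have "outer d" using out[of d] that by (simp add: in_star_iff)
    then show False using t by (simp add: outer_def touching_def)
  qed
  have anc: "\<exists>d'. src d' = v \<and> cls d' = cls d \<and> orphan d' \<and> (d' = d \<or> rk (cls d) (gen d') < rk (cls d) (gen d))"
    if "outer d" "src d = v" for d
    using ancestor[OF that(1)] nt that(2) by metis
  obtain d0 where d0: "d0 \<in> star (skel X) v" using ne by blast
  obtain d1 where d1: "d1 \<in> star (skel X) v" "d1 \<noteq> d0" using no_free_vertex[of v] v d0 by (auto simp: free_vertex_def)
  have o: "outer d0" "src d0 = v" "outer d1" "src d1 = v" using d0 d1 out by (auto simp: in_star_iff)
  show ?thesis
  proof (rule ccontr)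
    assume "\<not> ?thesis"
    then have uniq: "d = d'" if "orphan d" "orphan d'" "src d = v" "src d' = v" for d d' using that by blast
    obtain p where p: "orphan p" "src p = v" using anc[OF o(1,2)] by blast
    have cl: "cls d = cls p" if "outer d" "src d = v" for d using anc[OF that] uniq p by blast
    have "outer p" using p(1) by (simp add: orphan_def)
    from max_dart[OF this] obtain q where q: "outer q" "src q = src p" "cls q = cls p"
      "\<And>d''. outer d'' \<Longrightarrow> src d'' = src q \<Longrightarrow> cls d'' = cls q \<Longrightarrow> rk (cls q) (gen d'') \<le> rk (cls q) (gen q)" by metis
    have "orphan q \<or> (\<exists>d'. src d' = src q \<and> cls d' \<noteq> cls q \<and> (outer d' \<or> touching d'))"
      by (rule top_dart[OF q(1)]) (use q(4) in blast)
    then have "orphan q" using cl nt p(2) q(2,3) by metis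
    then have qp: "q = p" using uniq p q(2) by metis
    have "d = p" if d: "outer d" "src d = v" for d
    proof (rule ccontr)
      assume "d \<noteq> p"
      then have "rk (cls d) (gen p) < rk (cls d) (gen d)" using anc[OF d] uniq p by metis
      moreover have "rk (cls q) (gen d) \<le> rk (cls q) (gen q)" using q(4)[OF d(1)] d(2) cl[OF d] p(2) qp by simp
      ultimately show False using cl[OF d] qp by simp
    qed
    then show False using o d1(2) by metis
  qed
qed

text \<open>Every outer edge has two darts and every outer face two corners of angle 0, whose child
  darts are distinct; orphans are the outer darts left over.\<close>

lemma card_orphans:
  "card {d. orphan d} + 2 * card outer_faces = 2 * card {a \<in> arcs (skel X). fst (emap \<phi> a) \<notin> V1}"
proof -
  let ?I = "(\<lambda>(f, c). cdart f c) ` (outer_faces \<times> UNIV)"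
  have finF: "finite outer_faces" using fin by (simp add: outer_faces_def)
  have "inj_on (\<lambda>(f, c). cdart f c) (outer_faces \<times> UNIV)" using cdart_inj by (auto simp: inj_on_def)
  then have cI: "card ?I = 2 * card outer_faces" by (simp add: card_image card_cartesian_product)
  have O: "{d. outer d} = {a \<in> arcs (skel X). fst (emap \<phi> a) \<notin> V1} \<times> UNIV"
    by (auto simp: outer_def gen_def)
  have "{d. outer d} = {d. orphan d} \<union> ?I" using cdart_pdart(9) by (force simp: orphan_def)
  moreover have "{d. orphan d} \<inter> ?I = {}" by (auto simp: orphan_def)
  moreover have "finite {d. orphan d}" using finite_outer by (rule rev_finite_subset) (auto simp: orphan_def)
  ultimately have "card {d. outer d} = card {d. orphan d} + card ?I"
    using finF by (simp add: card_Un_disjoint)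
  then show ?thesis unfolding O cI by (simp add: card_cartesian_product)
qed

end

section \<open>Counting over the components of the preimage of the sub-LOT\<close>

context angled_squares
begin

text \<open>Among subsets of the vertices of \<open>X\<close>, these are the unions of vertex sets
  of components of the preimage of the sub-LOT.\<close>

definition inner_closed :: "'v set \<Rightarrow> bool" where
  "inner_closed S \<longleftrightarrow> (\<forall>a \<in> arcs (skel X). fst (emap \<phi> a) \<in> V1 \<longrightarrow> (tail (skel X) a \<in> S \<longleftrightarrow> head (skel X) a \<in> S))"

text \<open>One end of an arc and one corner of a face suffice as conditions, because an inner
  closed \<open>S\<close> contains the others with them.\<close>

definition inner :: "'v set \<Rightarrow> ('v, 'e, 'f) complex2" where
  "inner S = subcomplex X S {a \<in> arcs (skel X). fst (emap \<phi> a) \<in> V1 \<and> tail (skel X) a \<in> S}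
     {f \<in> faces X. \<psi> f \<in> E1 \<and> src (bd X f ! 0) \<in> S}"

text \<open>The conclusion of \<open>collapsing_dichotomy\<close> in the form of an assumption,
  since the locale knows only the sets \<open>V1\<close> and \<open>E1\<close> of the
  sub-LOT.\<close>

definition inner_dichotomy :: "'v set \<Rightarrow> bool" where
  "inner_dichotomy S \<longleftrightarrow> euler_char (inner S) \<le> 0 \<or>
     euler_char (inner S) = 1 \<and> (\<exists>h. height_function (inner S) \<phi> h) \<and>
       ((\<exists>a. free_edge (inner S) a) \<or> is_point (inner S) \<or>
        (\<exists>u v. u \<noteq> v \<and> free_vertex (inner S) u \<and> free_vertex (inner S) v))"

lemma inner_simps [simp]:
  "verts (skel (inner S)) = S"
  "arcs (skel (inner S)) = {a \<in> arcs (skel X). fst (emap \<phi> a) \<in> V1 \<and> tail (skel X) a \<in> S}"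
  "faces (inner S) = {f \<in> faces X. \<psi> f \<in> E1 \<and> src (bd X f ! 0) \<in> S}"
  "tail (skel (inner S)) = tail (skel X)" "head (skel (inner S)) = head (skel X)"
  "tail (doubled (skel (inner S))) = src" "head (doubled (skel (inner S))) = trg"
  "bd (inner S) = bd X"
  by (simp_all only: inner_def subcomplex_simps)

lemma inner_closed_dart:
  assumes "inner_closed S" "fst d \<in> arcs (skel X)" "gen d \<in> V1"
  shows "src d \<in> S \<longleftrightarrow> trg d \<in> S"
  using assms by (cases d) (auto simp: inner_closed_def gen_def)

lemma inner_arc_iff:
  assumes "inner_closed S"
  shows "fst d \<in> arcs (skel (inner S)) \<longleftrightarrow> fst d \<in> arcs (skel X) \<and> gen d \<in> V1 \<and> src d \<in> S"
  using assms by (cases d) (auto simp: inner_closed_def gen_def)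

lemma inner_face_arcs:
  assumes S: "inner_closed S" and f: "f \<in> faces X" "\<psi> f \<in> E1"
  shows "i < 4 \<Longrightarrow> src (bd X f ! i) \<in> S \<longleftrightarrow> src (bd X f ! 0) \<in> S"
    "i < 4 \<Longrightarrow> gen (bd X f ! i) \<in> V1"
proof -
  have g: "gen (bd X f ! i) \<in> V1" if "i < 4" for i
    using that E1_V1[OF f(2), of True] E1_V1[OF f(2), of False] bd_nth_map[OF f(1)]
    by (auto simp: less_4_iff gen_def simp del: fst_dart_map)
  have "src (bd X f ! i) \<in> S \<longleftrightarrow> trg (bd X f ! i) \<in> S" if "i < 4" for i
    using inner_closed_dart[OF S bd_nth_arc[OF f(1)] g] that by blast
  from this[of 0] this[of 1] this[of 2]
  have "src (bd X f ! 1) \<in> S \<longleftrightarrow> src (bd X f ! 0) \<in> S" "src (bd X f ! 2) \<in> S \<longleftrightarrow> src (bd X f ! 0) \<in> S"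
    "src (bd X f ! 3) \<in> S \<longleftrightarrow> src (bd X f ! 0) \<in> S"
    unfolding bd_nth_closed[OF f(1)] by simp_all
  then show "i < 4 \<Longrightarrow> src (bd X f ! i) \<in> S \<longleftrightarrow> src (bd X f ! 0) \<in> S"
    by (auto simp: less_4_iff simp del: One_nat_def doubled_simps)
  show "i < 4 \<Longrightarrow> gen (bd X f ! i) \<in> V1" by (rule g)
qed

lemma touching_arc: "touching d \<Longrightarrow> fst d \<in> arcs (skel X) \<and> gen d \<in> V1"
  using at_corner_arc unfolding touching_def by blast

lemma touching_inv: "touching d \<Longrightarrow> touching (inv_dart d)"
  using at_corner_inv unfolding touching_def gen_def fst_dart_map fst_inv_dart by blast

lemma finite_orphans: "finite {d. orphan d \<and> P d}"
  by (rule finite_subset[OF _ finite_outer]) (auto simp: orphan_def)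

lemma two_orphansI:
  assumes "orphan d" "src d \<in> S" "orphan d'" "src d' \<in> S" "d \<noteq> d'"
  shows "2 \<le> card {d. orphan d \<and> src d \<in> S}"
  using assms by (intro card_ge_2I[OF finite_orphans]) auto

text \<open>At a vertex of \<open>P\<close> without orphans \<open>touching_both\<close> gives
  touching darts of both classes. As \<open>\<epsilon>\<close> is constant on \<open>V1\<close>,
  they point in opposite directions, so their ends in \<open>P\<close> lie above and below. Hence
  both extremes of \<open>h\<close> on \<open>P\<close> carry orphans.\<close>

lemma touching_orphans:
  assumes S: "inner_closed S" "S \<subseteq> verts (skel X)" and h: "height_function (inner S) \<phi> h"
    and d: "touching d" "src d \<in> S"
  shows "2 \<le> card {d. orphan d \<and> src d \<in> S}"
proof -
  define P where "P = {v \<in> S. \<exists>d. touching d \<and> src d = v}"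
  have fin_P: "finite P" by (rule finite_subset[OF _ fin(1)]) (use S in \<open>auto simp: P_def\<close>)
  have trg: "trg k \<in> P" if "touching k" "src k \<in> S" for k
    using touching_inv[OF that(1)] inner_closed_dart[OF S(1), of k] touching_arc[OF that(1)] that(2)
    unfolding P_def tail_inv_dart[symmetric] by blast
  have ht: "h (trg k) = h (src k) + (if snd (\<mu> k) then 1 else - 1)" if "touching k" "src k \<in> S" for k
    using h[unfolded height_function_def, rule_format, of k] inner_arc_iff[OF S(1), of k] touching_arc[OF that(1)] that(2)
    unfolding inner_simps(6,7) by blast
  have step: "\<exists>w \<in> P. \<exists>w' \<in> P. h w = h v + 1 \<and> h w' = h v - 1"
    if v: "v \<in> P" and no: "\<And>k. src k = v \<Longrightarrow> \<not> orphan k" for v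
  proof -
    obtain k where k: "touching k" "src k = v" using v by (auto simp: P_def)
    have "\<exists>d'. touching d' \<and> src d' = src k \<and> cls d' = c" for c
      by (rule touching_both) (use k no in auto)
    then obtain k1 k2 where k1: "touching k1" "src k1 = v" "cls k1" and k2: "touching k2" "src k2 = v" "\<not> cls k2"
      using k(2) by metis
    have vS: "v \<in> S" using v by (simp add: P_def)
    have "snd (\<mu> k1) \<noteq> snd (\<mu> k2)"
      using k1(3) k2(3) \<epsilon>_V1[of "gen k1" "gen k2"] touching_arc[OF k1(1)] touching_arc[OF k2(1)]
      by (auto simp: cls_def)
    then show ?thesis
      using trg[of k1] trg[of k2] ht[of k1] ht[of k2] k1 k2 vS by (auto split: if_splits simp del: doubled_simps)
  qed
  have dP: "src d \<in> P" using d unfolding P_def by blast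
  then have "P \<noteq> {}" by blast
  with fin_P obtain v where v: "v \<in> P" "\<forall>w \<in> P. h w \<le> h v" using finite_has_maximum[of P h] by blast
  from \<open>P \<noteq> {}\<close> fin_P obtain v' where v': "v' \<in> P" "\<forall>w \<in> P. - h w \<le> - h v'"
    using finite_has_maximum[of P "\<lambda>w. - h w"] by blast
  obtain k where k: "orphan k" "src k = v" using step[OF v(1)] v(2) by force
  obtain k' where k': "orphan k'" "src k' = v'" using step[OF v'(1)] v'(2) by force
  have tP: "trg d \<in> P" using d trg by blast
  \<comment> \<open>A touching dart joins different heights, so the two extremes are attained at
    distinct vertices.\<close>
  have "h (trg d) \<noteq> h (src d)" using ht[OF d] by auto
  then have "v \<noteq> v'"
    using bspec[OF v(2) dP] bspec[OF v(2) tP] bspec[OF v'(2) dP] bspec[OF v'(2) tP] by auto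
  then have "k \<noteq> k'" using k k' by auto
  then show ?thesis using k k' v(1) v'(1) by (intro two_orphansI[of k _ k']) (auto simp: P_def)
qed

lemma component_orphans:
  assumes S: "inner_closed S" "S \<subseteq> verts (skel X)" and dich: "inner_dichotomy S"
  shows "2 * euler_char (inner S) \<le> int (card {d. orphan d \<and> src d \<in> S}) \<or> is_point X"
proof (cases "euler_char (inner S) \<le> 0")
  case False
  with dich obtain h where e: "euler_char (inner S) = 1" and h: "height_function (inner S) \<phi> h"
    and alt: "(\<exists>a. free_edge (inner S) a) \<or> is_point (inner S) \<or>
        (\<exists>u v. u \<noteq> v \<and> free_vertex (inner S) u \<and> free_vertex (inner S) v)"
    unfolding inner_dichotomy_def by blast
  have "2 \<le> card {d. orphan d \<and> src d \<in> S} \<or> is_point X"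
  proof (cases "\<exists>d. touching d \<and> src d \<in> S")
    case True
    then show ?thesis using touching_orphans[OF S h] by blast
  next
    case False
    then have nt: "\<not> touching d" if "src d \<in> S" for d using that by blast
    have anc: "\<exists>d'. orphan d' \<and> src d' = src d" if "outer d" "src d \<in> S" for d
      using ancestor[OF that(1)] nt that(2) by metis
    from alt consider a where "free_edge (inner S) a" | "is_point (inner S)"
      | u v where "u \<noteq> v" "free_vertex (inner S) u" "free_vertex (inner S) v" by blast
    then show ?thesis
    proof cases
      case 1
      then have a: "a \<in> arcs (skel (inner S))" by (simp add: free_edge_def)
      then have aX: "a \<in> arcs (skel X)" "fst (emap \<phi> a) \<in> V1" "tail (skel X) a \<in> S" by simp_all
      \<comment> \<open>\<open>a\<close> is free in the piece but not in \<open>X\<close>, so a face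
        outside the piece is attached along it. That face is outer, because a face over
        \<open>E1\<close> at \<open>a\<close> would lie in the piece; hence \<open>a\<close> would
        be touching.\<close>
      have "card (sides_at (inner S) a) = 1" using 1 unfolding free_edge_def ex1_iff_card_1 by blast
      moreover have "card (sides_at X a) \<noteq> 1" using no_free_edge[of a] aX(1) unfolding free_edge_def ex1_iff_card_1 by blast
      ultimately have "sides_at X a \<noteq> sides_at (inner S) a" by auto
      moreover have "sides_at (inner S) a \<subseteq> sides_at X a" by (auto simp: sides_at_def)
      ultimately obtain f i where fi: "(f, i) \<in> sides_at X a" "(f, i) \<notin> sides_at (inner S) a" by auto
      then have f: "f \<in> faces X" "i < 4" "fst (bd X f ! i) = a" by (auto simp: sides_at_def length_bd)
      have "f \<notin> faces (inner S)" using fi by (auto simp: sides_at_def)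
      have "f \<in> outer_faces"
      proof (rule ccontr)
        assume "f \<notin> outer_faces"
        then have fE: "\<psi> f \<in> E1" using f(1) by (simp add: outer_faces_def)
        have "src (bd X f ! i) \<in> S"
          using inner_arc_iff[OF S(1), of "bd X f ! i"] a f(3) by simp
        then have "src (bd X f ! 0) \<in> S" using inner_face_arcs(1)[OF S(1) f(1) fE f(2)] by simp
        then show False using \<open>f \<notin> faces (inner S)\<close> f(1) fE by simp
      qed
      moreover obtain b b' where "at_corner X (a, True) f b b'"
        using side_corner[OF f(1,2), of "(a, True)"] f(1,3) unfolding at_corner_def by (metis fst_conv)
      ultimately have "touching (a, True)" using aX(2) by (auto simp: touching_def gen_def)
      then show ?thesis using nt[of "(a, True)"] aX(3) by simp
    next
      case 2
      then obtain v where v: "S = {v}" by (auto simp: is_point_def)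
      have vX: "v \<in> verts (skel X)" using S(2) v by simp
      have out: "outer d" if "d \<in> star (skel X) v" for d
        using that 2 inner_arc_iff[OF S(1), of d] v by (auto simp: is_point_def in_star_iff outer_def simp del: inner_simps)
      show ?thesis
      proof (cases "star (skel X) v = {}")
        case True
        \<comment> \<open>Without darts at \<open>v\<close>, connectedness makes \<open>v\<close>
          the whole of \<open>X\<close>.\<close>
        have noarc: "tail (skel X) a \<noteq> v" "head (skel X) a \<noteq> v" if "a \<in> arcs (skel X)" for a
          using True that in_star_iff[of "(a, True)" "skel X" v] in_star_iff[of "(a, False)" "skel X" v] by auto
        have V: "verts (skel X) = {v}"
        proof (rule ccontr)
          assume "verts (skel X) \<noteq> {v}"
          then have "{v} \<subset> verts (skel X)" using vX by auto
          then obtain a where "a \<in> arcs (skel X)" "crosses (skel X) {v} a"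
            using X_connected unfolding cut_connected_def by blast
          then show False using noarc by (auto simp: crosses_def)
        qed
        have A: "arcs (skel X) = {}" using noarc(1) V src_in_verts by (metis doubled_simps(3) equals0I fst_conv singletonD case_prod_conv)
        then have "faces X = {}" using bd_nth_arc[of _ 0] by auto
        with V A show ?thesis by (auto simp: is_point_def)
      next
        case False
        from isolated_vertex_orphans[OF vX False out] show ?thesis using two_orphansI[of _ S] v by blast
      qed
    next
      case 3
      \<comment> \<open>\<open>w\<close> is not free in \<open>X\<close>, so a further dart starts
        there. It is outer and, in the absence of touching darts, has an orphan ancestor at
        \<open>w\<close>.\<close>
      have "\<exists>k. orphan k \<and> src k = w" if w: "free_vertex (inner S) w" for w
      proof -
        have wS: "w \<in> S" using w by (simp add: free_vertex_def)
        have "card (star (skel (inner S)) w) = 1" using w unfolding free_vertex_def ex1_iff_card_1 by blast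
        moreover have "card (star (skel X) w) \<noteq> 1"
          using no_free_vertex[of w] wS S(2) unfolding free_vertex_def ex1_iff_card_1 by blast
        ultimately have "star (skel X) w \<noteq> star (skel (inner S)) w" by auto
        moreover have "star (skel (inner S)) w \<subseteq> star (skel X) w" by (auto simp: in_star_iff)
        ultimately obtain d where d: "d \<in> star (skel X) w" "d \<notin> star (skel (inner S)) w" by blast
        then have "src d = w" "fst d \<in> arcs (skel X)" "fst d \<notin> arcs (skel (inner S))"
          by (auto simp: in_star_iff)
        then have "outer d" using inner_arc_iff[OF S(1), of d] wS unfolding outer_def by blast
        with anc[of d] \<open>src d = w\<close> wS show ?thesis by auto
      qed
      then obtain k k' where "orphan k" "src k = u" "orphan k'" "src k' = v" using 3 by blast
      then show ?thesis using 3 two_orphansI[of k S k'] by (auto simp: free_vertex_def)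
    qed
  qed
  then show ?thesis using e by linarith
qed simp

section \<open>Components of the preimage of the sub-LOT\<close>

definition component :: "'v \<Rightarrow> 'v set" where
  "component v = \<Inter> {S. S \<subseteq> verts (skel X) \<and> inner_closed S \<and> v \<in> S}"

lemma inner_closed_verts: "inner_closed (verts (skel X))"
  using wf by (auto simp: inner_closed_def wf_digraph_def)

lemma component_closed: "inner_closed (component v)"
  unfolding component_def inner_closed_def by blast

lemma component_least: "S \<subseteq> verts (skel X) \<Longrightarrow> inner_closed S \<Longrightarrow> v \<in> S \<Longrightarrow> component v \<subseteq> S"
  unfolding component_def by blast

lemma component_verts: "v \<in> verts (skel X) \<Longrightarrow> component v \<subseteq> verts (skel X)"
  using component_least[OF _ inner_closed_verts] by blast

lemma component_self: "v \<in> component v"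
  unfolding component_def by blast

text \<open>The complement of \<open>S\<close> in the component is inner closed as well, so
  whichever of the two contains \<open>v\<close> is the whole component.\<close>

lemma component_minimal:
  assumes v: "v \<in> verts (skel X)" and S: "inner_closed S" "S \<subseteq> component v" "S \<noteq> {}"
  shows "S = component v"
proof (cases "v \<in> S")
  case True
  then show ?thesis using component_least[of S v] component_verts[OF v] S by blast
next
  case False
  have "inner_closed (component v - S)" using component_closed[of v] S(1) by (auto simp: inner_closed_def)
  then have "component v \<subseteq> component v - S"
    using False component_verts[OF v] component_self by (intro component_least) auto
  then show ?thesis using S(2,3) by blast
qed

lemma component_eq:
  assumes "u \<in> verts (skel X)" "v \<in> verts (skel X)" "component u \<inter> component v \<noteq> {}"
  shows "component u = component v"
proof -
  have "inner_closed (component u \<inter> component v)"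
    using component_closed[of u] component_closed[of v] by (auto simp: inner_closed_def)
  then show ?thesis
    using component_minimal[OF assms(1), of "component u \<inter> component v"]
      component_minimal[OF assms(2), of "component u \<inter> component v"] assms(3) by blast
qed

text \<open>By minimality a proper nonempty subset is not inner closed, so an arc over
  \<open>V1\<close> crosses it.\<close>

lemma component_connected:
  assumes v: "v \<in> verts (skel X)"
  shows "cut_connected (skel (inner (component v)))"
  unfolding cut_connected_def
proof (intro conjI allI impI)
  show "verts (skel (inner (component v))) \<noteq> {}" using component_self by auto
  fix S assume S: "S \<subset> verts (skel (inner (component v)))" "S \<noteq> {}"
  then have "\<not> inner_closed S" using component_minimal[OF v, of S] by auto
  then obtain a where a: "a \<in> arcs (skel X)" "fst (emap \<phi> a) \<in> V1" "crosses (skel X) S a"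
    by (auto simp: inner_closed_def crosses_def)
  then have "tail (skel X) a \<in> component v"
    using S component_closed[of v] by (auto simp: crosses_def inner_closed_def)
  then show "\<exists>e\<in>arcs (skel (inner (component v))). crosses (skel (inner (component v))) S e"
    using a by (intro bexI[of _ a]) (auto simp: crosses_def)
qed

text \<open>\<open>g\<close> assigns each cell to one vertex, and the components partition the
  vertices.\<close>

lemma card_by_component:
  assumes "finite A" "\<And>x. x \<in> A \<Longrightarrow> g x \<in> verts (skel X)"
  shows "card A = (\<Sum>S \<in> component ` verts (skel X). card {x \<in> A. g x \<in> S})"
proof -
  have "A = (\<Union>S \<in> component ` verts (skel X). {x \<in> A. g x \<in> S})"
    using assms(2) component_self by blast
  also have "card \<dots> = (\<Sum>S \<in> component ` verts (skel X). card {x \<in> A. g x \<in> S})"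
    using fin assms component_eq by (intro card_UN_disjoint) auto
  finally show ?thesis .
qed

text \<open>Twice the Euler characteristic is the sum, over the components of the preimage, of twice
  theirs minus the orphans starting there; \<open>component_orphans\<close> bounds every summand by
  zero.\<close>

lemma euler_char_nonpos:
  assumes dich: "\<And>v. v \<in> verts (skel X) \<Longrightarrow> inner_dichotomy (component v)"
  shows "euler_char X \<le> 0 \<or> is_point X"
proof (cases "is_point X")
  case False
  let ?Q = "component ` verts (skel X)"
  let ?A = "{a \<in> arcs (skel X). fst (emap \<phi> a) \<in> V1}" and ?B = "{a \<in> arcs (skel X). fst (emap \<phi> a) \<notin> V1}"
  let ?F = "{f \<in> faces X. \<psi> f \<in> E1}"
  have V: "card (verts (skel X)) = (\<Sum>S \<in> ?Q. card S)"
  proof -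
    have "{x \<in> verts (skel X). x \<in> S} = S" if "S \<in> ?Q" for S using that component_verts by auto
    then show ?thesis using card_by_component[OF fin(1), of "\<lambda>x. x"] by simp
  qed
  have A: "card ?A = (\<Sum>S \<in> ?Q. card (arcs (skel (inner S))))"
    using card_by_component[of ?A "tail (skel X)"] fin wf by (simp add: wf_digraph_def conj_assoc)
  have F: "card ?F = (\<Sum>S \<in> ?Q. card (faces (inner S)))"
    using card_by_component[of ?F "\<lambda>f. src (bd X f ! 0)"] fin src_in_verts bd_nth_arc[of _ 0]
    by (simp add: conj_assoc del: doubled_simps)
  have O: "card {d. orphan d} = (\<Sum>S \<in> ?Q. card {d. orphan d \<and> src d \<in> S})"
    using card_by_component[of "{d. orphan d}" src] finite_orphans[of "\<lambda>_. True"] src_in_verts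
    by (simp add: orphan_def outer_def)
  have "card (arcs (skel X)) = card ?A + card ?B"
  proof -
    have "card (arcs (skel X)) = card (?A \<union> ?B)" by (rule arg_cong[of _ _ card]) blast
    then show ?thesis using fin by (simp add: card_Un_disjoint disjoint_iff)
  qed
  moreover have "card (faces X) = card ?F + card outer_faces"
  proof -
    have "card (faces X) = card (?F \<union> outer_faces)" by (rule arg_cong[of _ _ card]) (auto simp: outer_faces_def)
    then show ?thesis using fin by (simp add: card_Un_disjoint disjoint_iff outer_faces_def)
  qed
  \<comment> \<open>By \<open>card_orphans\<close>, twice the outer faces minus twice the outer
    edges is minus the number of orphans.\<close>
  ultimately have "2 * euler_char X =
      2 * (int (card (verts (skel X))) - int (card ?A) + int (card ?F)) - int (card {d. orphan d})"
    using card_orphans by (simp add: euler_char_def)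
  also have "\<dots> = (\<Sum>S \<in> ?Q. 2 * euler_char (inner S) - int (card {d. orphan d \<and> src d \<in> S}))"
    unfolding V A F O
    by (simp add: euler_char_def sum_subtractf sum.distrib sum_distrib_left[symmetric] del: inner_simps(2,3) doubled_simps)
  also have "\<dots> \<le> 0"
  proof (rule sum_nonpos)
    fix S assume "S \<in> ?Q"
    then obtain v where v: "v \<in> verts (skel X)" "S = component v" by blast
    show "2 * euler_char (inner S) - int (card {d. orphan d \<and> src d \<in> S}) \<le> 0"
      using component_orphans[OF component_closed component_verts[OF v(1)] dich[OF v(1)]] False
      unfolding v(2) by linarith
  qed
  finally show ?thesis by simp
qed simp

end

section \<open>The theorem\<close>

lemma identify_sub_LOT_simps:
  fixes \<Gamma> \<Gamma>1 :: "('v, 'e) lgraph" and y :: 'v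
  defines "q \<equiv> \<lambda>v. if v \<in> verts (ugraph \<Gamma>1) then y else v"
  shows "verts (ugraph (identify_sub_LOT \<Gamma> \<Gamma>1 y)) = q ` verts (ugraph \<Gamma>)"
    "arcs (ugraph (identify_sub_LOT \<Gamma> \<Gamma>1 y)) = arcs (ugraph \<Gamma>) - arcs (ugraph \<Gamma>1)"
    "arc_end (ugraph (identify_sub_LOT \<Gamma> \<Gamma>1 y)) e b = q (arc_end (ugraph \<Gamma>) e b)"
    "label (identify_sub_LOT \<Gamma> \<Gamma>1 y) e = q (label \<Gamma> e)"
  by (simp_all add: identify_sub_LOT_def q_def Let_def)

lemma compressed_arc_end:
  "compressed \<Gamma> \<Longrightarrow> e \<in> arcs (ugraph \<Gamma>) \<Longrightarrow> label \<Gamma> e \<noteq> arc_end (ugraph \<Gamma>) e b"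
  by (auto simp: compressed_def)

lemma sub_LOT_arc_end:
  assumes "sub_LOT \<Gamma>1 \<Gamma>" "e \<in> arcs (ugraph \<Gamma>1)"
  shows "e \<in> arcs (ugraph \<Gamma>)" "label \<Gamma> e \<in> verts (ugraph \<Gamma>1)" "arc_end (ugraph \<Gamma>) e b \<in> verts (ugraph \<Gamma>1)"
    "arc_end (ugraph \<Gamma>1) e b = arc_end (ugraph \<Gamma>) e b" "label \<Gamma>1 e = label \<Gamma> e"
  using assms by (auto simp: sub_LOT_def subgraph_def compatible_def wf_digraph_def)

text \<open>The sub-LOT has one vertex more than edges, and the labels of its edges are distinct
  elements of its vertex set. So at most one further edge has its label there, and the quotient
  merges no labels of remaining edges.\<close>

lemma injective_identify_sub_LOT:
  assumes \<Gamma>: "LOT \<Gamma>" and inj: "injective_LOG \<Gamma>" and sub: "sub_LOT \<Gamma>1 \<Gamma>" and y: "y \<in> verts (ugraph \<Gamma>1)"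
  shows "injective_LOG (identify_sub_LOT \<Gamma> \<Gamma>1 y)"
  unfolding injective_LOG_def
proof (rule inj_onI)
  let ?V1 = "verts (ugraph \<Gamma>1)" and ?E1 = "arcs (ugraph \<Gamma>1)"
  have injl: "inj_on (label \<Gamma>) (arcs (ugraph \<Gamma>))" using inj by (simp add: injective_LOG_def)
  have fin: "fin_digraph (ugraph \<Gamma>1)"
    using \<Gamma> sub unfolding LOT_def LOG_def sub_LOT_def subgraph_def fin_digraph_def fin_digraph_axioms_def
    by (auto intro: finite_subset)
  then have card: "card ?V1 = Suc (card ?E1)" using sub by (intro tree_card) (simp_all add: sub_LOT_def)
  interpret F: fin_digraph "ugraph \<Gamma>1" by (rule fin)
  fix e e' assume e: "e \<in> arcs (ugraph (identify_sub_LOT \<Gamma> \<Gamma>1 y))" "e' \<in> arcs (ugraph (identify_sub_LOT \<Gamma> \<Gamma>1 y))"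
    and eq: "label (identify_sub_LOT \<Gamma> \<Gamma>1 y) e = label (identify_sub_LOT \<Gamma> \<Gamma>1 y) e'"
  have e: "e \<in> arcs (ugraph \<Gamma>)" "e' \<in> arcs (ugraph \<Gamma>)" "e \<notin> ?E1" "e' \<notin> ?E1"
    using e by (simp_all add: identify_sub_LOT_simps)
  show "e = e'"
  proof (cases "label \<Gamma> e \<in> ?V1")
    case False
    then have "label \<Gamma> e = label \<Gamma> e'" using eq y by (auto simp: identify_sub_LOT_simps split: if_splits)
    then show ?thesis using injl e by (auto dest: inj_onD)
  next
    case True
    then have l: "label \<Gamma> e' \<in> ?V1" using eq y by (auto simp: identify_sub_LOT_simps split: if_splits)
    show ?thesis
    proof (rule ccontr)
      assume "e \<noteq> e'"
      then have "card (insert e (insert e' ?E1)) = Suc (Suc (card ?E1))" using e by simp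
      moreover have "inj_on (label \<Gamma>) (insert e (insert e' ?E1))"
        by (rule inj_on_subset[OF injl]) (use e sub_LOT_arc_end(1)[OF sub] in auto)
      ultimately have "card (label \<Gamma> ` insert e (insert e' ?E1)) = Suc (Suc (card ?E1))"
        by (simp only: card_image)
      moreover have "card (label \<Gamma> ` insert e (insert e' ?E1)) \<le> card ?V1"
        by (rule card_mono[OF F.finite_verts]) (use True l sub_LOT_arc_end(2)[OF sub] in auto)
      ultimately show False using card by simp
    qed
  qed
qed

theorem theorem7p1:
  fixes \<Gamma> \<Gamma>1 :: "('v, 'e) lgraph" and y :: 'v
  assumes "LOT \<Gamma>" and "reduced_LOG \<Gamma>" and "injective_LOG \<Gamma>"
    and "sub_LOT \<Gamma>1 \<Gamma>"
    and "collapsing_nonpositive_immersion (LOG_complex \<Gamma>1)"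
    and "y \<in> verts (ugraph \<Gamma>1)"
    and "LOT (identify_sub_LOT \<Gamma> \<Gamma>1 y)" and "reduced_LOG (identify_sub_LOT \<Gamma> \<Gamma>1 y)"
    and "\<not> (\<exists>\<Delta>. sub_LOT \<Delta> (identify_sub_LOT \<Gamma> \<Gamma>1 y) \<and> boundary_reducible \<Delta>)"
  shows "collapsing_nonpositive_immersion (LOG_complex \<Gamma>)"
proof -
  define V1 where "V1 = verts (ugraph \<Gamma>1)"
  define E1 where "E1 = arcs (ugraph \<Gamma>1)"
  define D where "D = identify_sub_LOT \<Gamma> \<Gamma>1 y"
  define q where "q v = (if v \<in> V1 then y else v)" for v
  have yV1: "y \<in> V1" using assms(6) by (simp add: V1_def)
  have D: "verts (ugraph D) = q ` verts (ugraph \<Gamma>)" "arcs (ugraph D) = arcs (ugraph \<Gamma>) - E1"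
    "arc_end (ugraph D) e b = q (arc_end (ugraph \<Gamma>) e b)" "label D e = q (label \<Gamma> e)" for e b
    unfolding D_def E1_def q_def V1_def identify_sub_LOT_simps by simp_all
  have comp: "label \<Gamma> e \<noteq> arc_end (ugraph \<Gamma>) e b" if "e \<in> arcs (ugraph \<Gamma>)" for e b
    using assms(2) that by (intro compressed_arc_end) (simp_all add: reduced_LOG_def)
  have comp1: "label \<Gamma>1 e \<noteq> arc_end (ugraph \<Gamma>1) e b" if "e \<in> arcs (ugraph \<Gamma>1)" for e b
    using sub_LOT_arc_end[OF assms(4) that] comp by metis
  \<comment> \<open>The quotient is compressed, so the label and an end of an edge outside the
    sub-LOT never both lie in \<open>V1\<close>.\<close>
  have "q (label \<Gamma> e) \<noteq> q (arc_end (ugraph \<Gamma>) e b)" if "e \<in> arcs (ugraph \<Gamma>) - E1" for e b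
  proof -
    have "compressed D" using assms(8) by (simp add: reduced_LOG_def D_def)
    from compressed_arc_end[OF this, of e b] that show ?thesis unfolding D by blast
  qed
  then have not_both: "arc_end (ugraph \<Gamma>) e b \<notin> V1"
    if "e \<in> arcs (ugraph \<Gamma>) - E1" "label \<Gamma> e \<in> V1" for e b
    using that unfolding q_def by metis
  have D_LOT: "LOT D" and D_inj: "injective_LOG D"
    and D_nobr: "\<not> (\<exists>\<Delta>. sub_LOT \<Delta> D \<and> boundary_reducible \<Delta>)"
    using assms(7,9) injective_identify_sub_LOT[OF assms(1,3,4,6)] by (simp_all add: D_def)
  have y_D: "y \<in> verts (ugraph D)"
  proof -
    have "y \<in> verts (ugraph \<Gamma>)" using assms(4,6) by (auto simp: sub_LOT_def subgraph_def)
    moreover have "q y = y" by (simp add: q_def)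
    ultimately show ?thesis unfolding D by force
  qed
  obtain \<sigma> :: "'v \<Rightarrow> bool" and ch pa :: "bool \<Rightarrow> 'e \<Rightarrow> 'v" and rk :: "bool \<Rightarrow> 'v \<Rightarrow> nat" where
    ch: "\<And>c. bij_betw (ch c) (arcs (ugraph D)) (verts (ugraph D) - {y})"
    and cp: "\<And>c e. e \<in> arcs (ugraph D) \<Longrightarrow>
       (ch c e, pa c e) \<in> {(label D e, arc_end (ugraph D) e (\<sigma> (label D e) = c)),
                          (arc_end (ugraph D) e (\<sigma> (label D e) = c), label D e)}"
    and rk: "\<And>c e. e \<in> arcs (ugraph D) \<Longrightarrow> rk c (pa c e) < rk c (ch c e)"
    by (rule label_trees[OF D_LOT D_inj D_nobr y_D]) (rule that)
  \<comment> \<open>\<open>V1\<close> survives in the quotient only as \<open>y\<close>, the root of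
    both trees, and a root is no child.\<close>
  have ch_V1: "ch c e \<notin> V1" if "e \<in> arcs (ugraph \<Gamma>) - E1" for c e
  proof -
    have "ch c e \<in> q ` verts (ugraph \<Gamma>) - {y}" using ch[of c] that unfolding D bij_betw_def by blast
    then show ?thesis by (auto simp: q_def)
  qed
  \<comment> \<open>Pulled back from the quotient, so that it is constant on
    \<open>V1\<close>.\<close>
  define \<epsilon> where "\<epsilon> x = \<sigma> (q x)" for x
  \<comment> \<open>A child lies outside \<open>V1\<close> and needs no change, but a parent
    \<open>y\<close> in the quotient is lifted to the actual generator of \<open>\<Gamma>\<close>,
    which may be any vertex of \<open>V1\<close>.\<close>
  define pa' where "pa' c e = (if ch c e = label \<Gamma> e then arc_end (ugraph \<Gamma>) e (\<epsilon> (label \<Gamma> e) = c) else label \<Gamma> e)"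
    for c e
  have qV1: "x = q z \<Longrightarrow> x \<notin> V1 \<Longrightarrow> x = z" for x z using yV1 by (auto simp: q_def split: if_splits)
  have cp': "(ch c e, pa' c e) \<in> {(label \<Gamma> e, arc_end (ugraph \<Gamma>) e (\<epsilon> (label \<Gamma> e) = c)),
      (arc_end (ugraph \<Gamma>) e (\<epsilon> (label \<Gamma> e) = c), label \<Gamma> e)} \<and> pa c e = q (pa' c e)"
    if e: "e \<in> arcs (ugraph \<Gamma>) - E1" for c e
  proof -
    let ?o = "arc_end (ugraph \<Gamma>) e (\<epsilon> (label \<Gamma> e) = c)"
    have "(ch c e, pa c e) \<in> {(q (label \<Gamma> e), q ?o), (q ?o, q (label \<Gamma> e))}"
      using cp[of e c] e unfolding D \<epsilon>_def by blast
    then consider "ch c e = q (label \<Gamma> e)" "pa c e = q ?o" | "ch c e = q ?o" "pa c e = q (label \<Gamma> e)" by blast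
    then show ?thesis
    proof cases
      case 1
      then have "ch c e = label \<Gamma> e" using qV1 ch_V1[OF e] by blast
      then show ?thesis using 1 by (simp add: pa'_def del: doubled_simps)
    next
      case 2
      then have "ch c e = ?o" using qV1 ch_V1[OF e] by blast
      moreover have "?o \<noteq> label \<Gamma> e" by (rule not_sym[OF comp]) (use e in blast)
      ultimately show ?thesis using 2 by (simp add: pa'_def del: doubled_simps)
    qed
  qed
  show ?thesis
    unfolding collapsing_nonpositive_immersion_def
  proof (intro allI impI, elim conjE)
    fix X :: "(nat, nat, nat) complex2" and \<phi> :: "(nat, nat, nat, unit, 'v, 'e) cell_map"
    assume X: "is_complex2 X" "finite_complex2 X" "connected (skel X)"
      and nf: "\<nexists>v. free_vertex X v" "\<nexists>a. free_edge X a"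
      and comb: "combinatorial_map X (LOG_complex \<Gamma>) \<phi>" and im: "immersion X \<phi>"
    from immersion_imp_square_immersion[OF X(1,2) comb im] obtain bd'
      where sq: "square_immersion (X\<lparr>bd := bd'\<rparr>) \<Gamma> \<phi>"
        and fe: "\<And>a. free_edge (X\<lparr>bd := bd'\<rparr>) a \<longleftrightarrow> free_edge X a" by metis
    define Y where "Y = X\<lparr>bd := bd'\<rparr>"
    have Y: "skel Y = skel X" "faces Y = faces X" by (simp_all add: Y_def)
    have con: "cut_connected (skel Y)"
      using X(1,3) connected_iff_cut_connected unfolding Y is_complex2_def by blast
    interpret angled_squares Y \<Gamma> \<phi> V1 E1 \<epsilon> ch pa' rk
    proof unfold_locales
      show "square_immersion Y \<Gamma> \<phi>" using sq by (simp add: Y_def)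
      show "\<not> free_edge Y a" for a using fe nf by (simp add: Y_def)
      show "\<not> free_vertex Y v" for v using nf by (simp add: free_vertex_def Y)
      show "cut_connected (skel Y)" by (rule con)
      show "label \<Gamma> e \<in> V1 \<and> arc_end (ugraph \<Gamma>) e b \<in> V1" if "e \<in> E1" for e b
        using sub_LOT_arc_end(2,3)[OF assms(4)] that by (simp add: V1_def E1_def)
      show "\<epsilon> z = \<epsilon> z'" if "z \<in> V1" "z' \<in> V1" for z z' using that by (simp add: \<epsilon>_def q_def)
      show "arc_end (ugraph \<Gamma>) e b \<notin> V1" if "e \<in> arcs (ugraph \<Gamma>) - E1" "label \<Gamma> e \<in> V1" for e b
        using not_both that by blast
      show "inj_on (ch c) (arcs (ugraph \<Gamma>) - E1)" for c using ch[of c] by (simp add: bij_betw_def D)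
      show "ch c e \<notin> V1" if "e \<in> arcs (ugraph \<Gamma>) - E1" for c e using ch_V1 that .
      show "(ch c e, pa' c e) \<in> {(label \<Gamma> e, arc_end (ugraph \<Gamma>) e (\<epsilon> (label \<Gamma> e) = c)),
          (arc_end (ugraph \<Gamma>) e (\<epsilon> (label \<Gamma> e) = c), label \<Gamma> e)}" if "e \<in> arcs (ugraph \<Gamma>) - E1" for c e
        using cp'[OF that] by blast
      \<comment> \<open>Outside \<open>V1\<close> the map \<open>q\<close> is the identity, so
        parents there keep their ranks.\<close>
      show "rk c (pa' c e) < rk c (ch c e)" if "e \<in> arcs (ugraph \<Gamma>) - E1" "pa' c e \<notin> V1" for c e
        using rk[of e c] cp'[OF that(1), of c] that by (simp add: D q_def)
      show "label \<Gamma> e \<noteq> arc_end (ugraph \<Gamma>) e b" if "e \<in> arcs (ugraph \<Gamma>)" for e b using comp[OF that] .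
    qed
    \<comment> \<open>Each component of the preimage is immersed in the complex of
      \<open>\<Gamma>1\<close>, where the hypothesis holds; its faces keep their words because
      labels and ends of the edges of \<open>\<Gamma>1\<close> agree with those in
      \<open>\<Gamma>\<close>.\<close>
    have "inner_dichotomy (component v)" if v: "v \<in> verts (skel Y)" for v
      unfolding inner_dichotomy_def
    proof (rule collapsing_dichotomy[OF assms(5) comp1 _ component_connected[OF v]])
      show "square_immersion (inner (component v)) \<Gamma>1 \<phi>"
        unfolding inner_def
      proof (rule subcomplex_square_immersion[OF imm])
        show "component v \<subseteq> verts (skel Y)" by (rule component_verts[OF v])
        show "bd (LOG_complex \<Gamma>1) e = bd (LOG_complex \<Gamma>) e" if "e \<in> arcs (ugraph \<Gamma>1)" for e
          using sub_LOT_arc_end(4)[OF assms(4) that, of True] sub_LOT_arc_end(4)[OF assms(4) that, of False]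
            sub_LOT_arc_end(5)[OF assms(4) that] by simp
        fix a assume "a \<in> {a \<in> arcs (skel Y). fst (emap \<phi> a) \<in> V1 \<and> tail (skel Y) a \<in> component v}"
        then show "tail (skel Y) a \<in> component v \<and> head (skel Y) a \<in> component v \<and>
            fst (emap \<phi> a) \<in> verts (ugraph \<Gamma>1)"
          using component_closed[of v, unfolded inner_closed_def] unfolding V1_def by blast
      next
        fix f assume "f \<in> {f \<in> faces Y. face_map \<phi> f \<in> E1 \<and> tail (doubled (skel Y)) (bd Y f ! 0) \<in> component v}"
        then have f: "f \<in> faces Y" "face_map \<phi> f \<in> E1" "tail (doubled (skel Y)) (bd Y f ! 0) \<in> component v" by blast+
        have "fst d \<in> {a \<in> arcs (skel Y). fst (emap \<phi> a) \<in> V1 \<and> tail (skel Y) a \<in> component v}"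
          if d: "d \<in> set (bd Y f)" for d
        proof -
          obtain i where i: "i < 4" "bd Y f ! i = d" using d unfolding in_set_conv_nth length_bd[OF f(1)] by blast
          have "fst d \<in> arcs (skel (inner (component v)))"
            using inner_arc_iff[OF component_closed, of d v] inner_face_arcs[OF component_closed f(1,2) i(1)]
              bd_nth_arc[OF f(1) i(1)] f(3) i(2) by blast
          then show ?thesis by simp
        qed
        then show "fst ` set (bd Y f) \<subseteq> {a \<in> arcs (skel Y). fst (emap \<phi> a) \<in> V1 \<and> tail (skel Y) a \<in> component v} \<and>
            face_map \<phi> f \<in> arcs (ugraph \<Gamma>1)"
          using f(2) unfolding E1_def by blast
      qed auto
    qed
    then have "euler_char Y \<le> 0 \<or> is_point Y" by (rule euler_char_nonpos)
    then show "euler_char X \<le> 0 \<or> is_point X" by (simp add: euler_char_def is_point_def Y)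
  qed
qed

end
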